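(* Let $k$ be a positive integer, $p>1$, and let $(\alpha_0,\ldots,\alpha_k)\in\mathbb R^{k+1}$ with $\alpha_k-kp+1=0$. Let $\eta>-1$, $\gamma=(2p-1+(p-1)\eta)/p$, and let $\theta\in\mathbb R$ satisfy $\theta+2>\gamma$ and $\theta>\lfloor\frac k2\rfloor(\theta+2-\gamma)-1$. Let $\beta_{0,k}$ be the constant given in the context. Then there exists a sequence $(u_n)$ in $X^{k,p}_\infty(\alpha_0,\ldots,\alpha_k)$ such that $\|\nabla_L^ku_n\|_{L^p_{\alpha_k+\lfloor\frac k2\rfloor(\theta-\gamma)p}}\le1$ for all $n$ and $$\frac1{\|u_n\|^p_{L^p_\eta}}\int_0^\infty\frac{\exp_p\left(\beta_{0,k}|u_n|^{\frac p{p-1}}\right)}{(1+|u_n|)^q}\,r^\eta\,dr\longrightarrow\infty\quad\text{as }n\to\infty,\qquad\forall\, q<\frac p{p-1}.$$ Moreover, for all $\beta>\beta_{0,k}$ and $q\ge0$, $$\int_0^\infty\frac{\exp_p\left(\beta|u_n|^{\frac p{p-1}}\right)}{(1+|u_n|)^q}\,r^\eta\,dr\longrightarrow\infty\quad\text{as }n\to\infty.$$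
   Context: For $p\ge1$ and $\alpha\in\mathbb R$, $\|u\|_{L^p_\alpha}=\left(\int_0^\infty|u|^pr^\alpha\,dr\right)^{1/p}$, and $L^p_\alpha$ is the space of measurable $u:(0,\infty)\to\mathbb R$ with finite such norm. $X^{k,p}_\infty(\alpha_0,\ldots,\alpha_k)$ is the space of functions $u:(0,\infty)\to\mathbb R$ whose weak derivatives satisfy $u^{(j)}\in L^p_{\alpha_j}$ for $j=0,\ldots,k$ (so $u^{(k-1)}$ is locally absolutely continuous on $(0,\infty)$). $L_{\theta,\gamma}u=-r^{-\theta}(r^\gamma u')'$; $\nabla^k_Lu=L_{\theta,\gamma}^{k/2}u$ if $k$ is even and $\nabla_L^ku=(L_{\theta,\gamma}^{(k-1)/2}u)'$ if $k$ is odd. For real $p>1$ and $t\ge0$, $\exp_p(t):=\sum_{j=0}^\infty\frac{t^{p-1+j}}{\Gamma(p+j)}$. The constant $\beta_{0,k}$ is $$\beta_{0,k}=\begin{cases}(\eta+1)\left[(\gamma-1)(\theta+2-\gamma)^{k-2}\dfrac{\Gamma\left(\frac k2\right)\Gamma\left(\frac{\gamma-1}{\theta+2-\gamma}\right)}{\Gamma\left(\frac{\gamma-1}{\theta+2-\gamma}-\frac{k-2}2\right)}\right]^{\frac p{p-1}}&\text{if }k\text{ is even},\\[4mm](\eta+1)\left[(\gamma-1)(\theta+2-\gamma)^{k-2}\dfrac{\Gamma\left(\frac{k+1}2\right)\Gamma\left(\frac{\gamma-1}{\theta+2-\gamma}\right)}{\Gamma\left(\frac{\gamma-1}{\theta+2-\gamma}-\frac{k-3}2\right)}\right]^{\frac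 p{p-1}}&\text{if }k\text{ is odd}.\end{cases}$$ *)

theory Defs
  imports "HOL-Analysis.Analysis"
begin

text \<open>
  Functions on the half-line \<open>(0,\<infinity>)\<close> are total functions \<open>real \<Rightarrow> real\<close> of which only the
  values on \<open>{0<..}\<close> matter.
\<close>

text \<open>
  Real powers of extended nonnegative reals, intended for exponents \<open>s > 0\<close>.
\<close>

definition epowr :: "ennreal \<Rightarrow> real \<Rightarrow> ennreal" where
  "epowr x s = (if x = \<infinity> then \<infinity> else ennreal (enn2real x powr s))"

definition wnorm :: "real \<Rightarrow> real \<Rightarrow> (real \<Rightarrow> real) \<Rightarrow> ennreal" where
  "wnorm p a u =
     epowr (\<integral>\<^sup>+ r. ennreal (\<bar>u r\<bar> powr p * r powr a) \<partial>lebesgue_on {0<..}) (1 / p)"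

definition Lp_weighted :: "real \<Rightarrow> real \<Rightarrow> (real \<Rightarrow> real) set" where
  "Lp_weighted p a = {u. u \<in> borel_measurable (lebesgue_on {0<..}) \<and> wnorm p a u < \<infinity>}"

definition L1_loc :: "(real \<Rightarrow> real) set" where
  "L1_loc = {u. \<forall>K. compact K \<longrightarrow> K \<subseteq> {0<..} \<longrightarrow> u absolutely_integrable_on K}"

text \<open>The test functions \<open>C\<^sub>c\<^sup>\<infinity>(0,\<infinity>)\<close>, extended by zero to the whole line.\<close>

definition test_functions :: "(real \<Rightarrow> real) set" where
  "test_functions =
     {\<phi>. (\<forall>j x. (deriv ^^ j) \<phi> differentiable at x) \<and>
          compact (closure {x. \<phi> x \<noteq> 0}) \<and> closure {x. \<phi> x \<noteq> 0} \<subseteq> {0<..}}"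

text \<open>
  \<open>has_weak_deriv j u v\<close>: \<open>v\<close> is a version of the \<open>j\<close>-th weak derivative of \<open>u\<close> on \<open>(0,\<infinity>)\<close>.
  Such a \<open>v\<close> is unique up to null sets, and for \<open>j = 0\<close> the relation is equality almost everywhere.
\<close>

definition has_weak_deriv :: "nat \<Rightarrow> (real \<Rightarrow> real) \<Rightarrow> (real \<Rightarrow> real) \<Rightarrow> bool" where
  "has_weak_deriv j u v \<longleftrightarrow>
     u \<in> L1_loc \<and> v \<in> L1_loc \<and>
     (\<forall>\<phi>\<in>test_functions.
        integral\<^sup>L (lebesgue_on {0<..}) (\<lambda>r. u r * (deriv ^^ j) \<phi> r) =
        (- 1) ^ j * integral\<^sup>L (lebesgue_on {0<..}) (\<lambda>r. v r * \<phi> r))"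

definition X_space :: "nat \<Rightarrow> real \<Rightarrow> (nat \<Rightarrow> real) \<Rightarrow> (real \<Rightarrow> real) set" where
  "X_space k p \<alpha> =
     {u. u \<in> Lp_weighted p (\<alpha> 0) \<and>
         (\<forall>j\<in>{1..k}. \<exists>v. has_weak_deriv j u v \<and> v \<in> Lp_weighted p (\<alpha> j))}"

text \<open>
  The operators \<open>L\<^bsub>\<theta>,\<gamma>\<^esub>\<close>, its powers and \<open>\<nabla>\<^sub>L\<^sup>k\<close> act through weak derivatives, which are determined
  only up to null sets; hence they are relations between a function and a version of its image.
\<close>

definition has_L :: "real \<Rightarrow> real \<Rightarrow> (real \<Rightarrow> real) \<Rightarrow> (real \<Rightarrow> real) \<Rightarrow> bool" where
  "has_L \<theta> \<gamma> u w \<longleftrightarrow>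
     (\<exists>u' g. has_weak_deriv 1 u u' \<and> has_weak_deriv 1 (\<lambda>r. r powr \<gamma> * u' r) g \<and>
             (\<forall>r>0. w r = - (r powr (- \<theta>)) * g r))"

primrec has_L_power ::
    "real \<Rightarrow> real \<Rightarrow> nat \<Rightarrow> (real \<Rightarrow> real) \<Rightarrow> (real \<Rightarrow> real) \<Rightarrow> bool" where
  "has_L_power \<theta> \<gamma> 0 u w \<longleftrightarrow> (\<forall>r>0. w r = u r)"
| "has_L_power \<theta> \<gamma> (Suc m) u w \<longleftrightarrow> (\<exists>v. has_L_power \<theta> \<gamma> m u v \<and> has_L \<theta> \<gamma> v w)"

definition has_nabla_L ::
    "real \<Rightarrow> real \<Rightarrow> nat \<Rightarrow> (real \<Rightarrow> real) \<Rightarrow> (real \<Rightarrow> real) \<Rightarrow> bool" where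
  "has_nabla_L \<theta> \<gamma> k u w \<longleftrightarrow>
     (if even k then has_L_power \<theta> \<gamma> (k div 2) u w
      else \<exists>v. has_L_power \<theta> \<gamma> ((k - 1) div 2) u v \<and> has_weak_deriv 1 v w)"

definition exp_p :: "real \<Rightarrow> real \<Rightarrow> real" where
  "exp_p p t = (\<Sum>j. t powr (p - 1 + real j) / Gamma (p + real j))"

definition beta0 :: "nat \<Rightarrow> real \<Rightarrow> real \<Rightarrow> real \<Rightarrow> real \<Rightarrow> real" where
  "beta0 k p \<eta> \<theta> \<gamma> =
     (if even k then
        (\<eta> + 1) *
        ((\<gamma> - 1) * (\<theta> + 2 - \<gamma>) powi (int k - 2) *
          (Gamma (real k / 2) * Gamma ((\<gamma> - 1) / (\<theta> + 2 - \<gamma>)) /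
           Gamma ((\<gamma> - 1) / (\<theta> + 2 - \<gamma>) - (real k - 2) / 2))) powr (p / (p - 1))
      else
        (\<eta> + 1) *
        ((\<gamma> - 1) * (\<theta> + 2 - \<gamma>) powi (int k - 2) *
          (Gamma ((real k + 1) / 2) * Gamma ((\<gamma> - 1) / (\<theta> + 2 - \<gamma>)) /
           Gamma ((\<gamma> - 1) / (\<theta> + 2 - \<gamma>) - (real k - 3) / 2))) powr (p / (p - 1)))"

text \<open>
  The functional is valued in \<open>[0,\<infinity>]\<close>, so that no integrability has to be presupposed.
\<close>

definition exp_functional ::
    "real \<Rightarrow> real \<Rightarrow> real \<Rightarrow> real \<Rightarrow> (real \<Rightarrow> real) \<Rightarrow> ennreal" where
  "exp_functional p \<eta> \<beta> q u =
     (\<integral>\<^sup>+ r. ennreal (exp_p p (\<beta> * \<bar>u r\<bar> powr (p / (p - 1))) / (1 + \<bar>u r\<bar>) powr q * r powr \<eta>)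
        \<partial>lebesgue_on {0<..})"

end

theory Submission
  imports Defs "HOL-Real_Asymp.Real_Asymp"
begin

text \<open>
  In the logarithmic variable \<open>t = - ln r\<close> the problem has constant coefficients. Put \<open>a
  = \<gamma> - 1\<close>, \<open>\<tau> = \<theta> + 2 - \<gamma>\<close> and \<open>m = k div 2\<close>. If
  \<open>u r = U (- ln r)\<close>, then \<open>\<nabla>\<^sub>L\<^sup>k u\<close> is a power of
  \<open>r\<close> times \<open>P(D) U\<close>, where \<open>P\<close> is, up to sign, the product over
  \<open>j < m\<close> of \<open>(a - j \<tau> - X)(j \<tau> + X)\<close>, with a further factor \<open>m
  \<tau> + X\<close> if \<open>k\<close> is odd (\<open>radial_has_nabla_L\<close>). The condition
  \<open>\<alpha> k = k p - 1\<close> is exactly what turns the weighted norm of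
  \<open>\<nabla>\<^sub>L\<^sup>k u\<close> into the unweighted norm of \<open>P(D) U\<close> in
  \<open>L\<^sup>p(dt)\<close>. The polynomial \<open>P\<close> has no constant term, and if
  \<open>c\<close> denotes the absolute value of its linear coefficient, then \<open>beta0 = (\<eta> + 1) *
  c powr (p / (p - 1))\<close> (\<open>beta0_eq_symbol\<close>).

  So for an affine profile of slope \<open>\<lambda>\<close> the operator \<open>P(D)\<close> is
  multiplication of the slope by \<open>c\<close>, up to sign, and for a constant one it is zero. A
  concentrating sequence is therefore obtained as for the first order Moser functions: let \<open>U\<close>
  rise with slope \<open>\<lambda>\<close> over a length \<open>T\<close>, remain at the height \<open>A =
  \<lambda> T\<close> on a plateau, and then decrease very slowly to zero, with all corners smoothed at the
  fixed scale \<open>k\<close>. The rise contributes \<open>(\<lambda> c)\<^sup>p T\<close> to the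
  \<open>p\<close>-th power of the norm, and the corners and the descent contribute
  \<open>O(\<lambda>\<^sup>p)\<close>; so \<open>\<lambda> = (c\<^sup>p T + K) powr (- 1 / p)\<close> is
  admissible (\<open>concentrating_profile\<close>). The slow descent makes \<open>u\<close> compactly
  supported in \<open>(0,\<infinity>)\<close>, hence \<open>u\<close> lies in \<open>X_space k p
  \<alpha>\<close> for arbitrary \<open>\<alpha> 0, \<dots>, \<alpha> (k - 1)\<close>.

  With \<open>p' = p / (p - 1)\<close>, on the plateau \<open>beta0 * A powr p' \<ge> (\<eta> + 1) * T -
  O(1)\<close> (\<open>profile_height_lower_bound\<close>), while the part of the plateau with \<open>T + k
  \<le> t \<le> T + k + 1\<close> has \<open>r\<^sup>\<eta> dr\<close>-measure comparable to \<open>exp (-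
  (\<eta> + 1) * T)\<close>. The two exponentials cancel, and \<open>exp_p\<close> is bounded below by a
  multiple of the exponential, so at \<open>\<beta> = beta0\<close> the functional is at least a constant
  times \<open>(1 + A) powr (- q)\<close>, where \<open>A\<close> is of order \<open>T powr (1 /
  p')\<close>. The norm of \<open>u\<close> in \<open>L\<^sup>p(r\<^sup>\<eta> dr)\<close> has
  \<open>p\<close>-th power \<open>O(\<lambda>\<^sup>p) = O(1 / T)\<close>, because \<open>U\<close> is at
  most a multiple of \<open>\<lambda> t\<close> and the weight decays exponentially in \<open>t\<close>
  (\<open>log_moment_bound\<close>). The quotient is thus at least a constant times \<open>T powr (1 - max q
  0 / p')\<close>, which tends to infinity for \<open>q < p'\<close>. For \<open>\<beta> > beta0\<close> the
  exponentials do not cancel and the functional itself grows exponentially in \<open>T\<close>.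
\<close>

section \<open>Test functions and weak derivatives\<close>

lemma test_functions_has_derivative:
  assumes "\<phi> \<in> test_functions"
  shows "(\<phi> has_real_derivative deriv \<phi> x) (at x)"
proof -
  have "(deriv ^^ 0) \<phi> differentiable at x"
    using assms unfolding test_functions_def by blast
  then show ?thesis
    by (simp add: DERIV_deriv_iff_real_differentiable)
qed

lemma test_functions_deriv:
  assumes "\<phi> \<in> test_functions"
  shows "deriv \<phi> \<in> test_functions"
proof -
  let ?K = "closure {x. \<phi> x \<noteq> 0}"
  have K: "compact ?K" "?K \<subseteq> {0<..}"
    using assms by (auto simp: test_functions_def)
  have "deriv \<phi> x = 0" if "x \<notin> ?K" for x
  proof -
    have "eventually (\<lambda>y. y \<in> - ?K) (nhds x)"
      using that by (intro eventually_nhds_in_open) auto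
    then have "eventually (\<lambda>y. \<phi> y = 0) (nhds x)"
      by (rule eventually_mono) (use closure_subset[of "{x. \<phi> x \<noteq> 0}"] in auto)
    then have "deriv \<phi> x = deriv (\<lambda>_. 0) x"
      by (intro deriv_cong_ev) auto
    then show ?thesis by simp
  qed
  then have "{x. deriv \<phi> x \<noteq> 0} \<subseteq> ?K" by blast
  then have *: "closure {x. deriv \<phi> x \<noteq> 0} \<subseteq> ?K"
    by (simp add: closure_minimal)
  moreover have "compact (closure {x. deriv \<phi> x \<noteq> 0})"
    using * K(1) by (metis closed_closure compact_Int_closed inf.absorb_iff2)
  moreover have "(deriv ^^ j) (deriv \<phi>) differentiable at x" for j x
  proof -
    have "(deriv ^^ Suc j) \<phi> differentiable at x"
      using assms unfolding test_functions_def by blast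
    then show ?thesis by (simp add: funpow_swap1)
  qed
  ultimately show ?thesis
    using K(2) by (auto simp: test_functions_def)
qed

lemma test_functions_iterated_deriv:
  "\<phi> \<in> test_functions \<Longrightarrow> (deriv ^^ j) \<phi> \<in> test_functions"
  by (induction j) (auto intro: test_functions_deriv)

lemma test_functions_support:
  assumes "\<phi> \<in> test_functions"
  obtains a b where "0 < a" "a < b" "\<And>x. x \<notin> {a..b} \<Longrightarrow> \<phi> x = 0" "\<phi> a = 0" "\<phi> b = 0"
proof (cases "closure {x. \<phi> x \<noteq> 0} = {}")
  case True
  then have "\<phi> x = 0" for x by auto
  then show ?thesis using that[of 1 2] by auto
next
  case False
  let ?K = "closure {x. \<phi> x \<noteq> 0}"
  have K: "compact ?K" "?K \<subseteq> {0<..}"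
    using assms by (auto simp: test_functions_def)
  obtain m where m: "m \<in> ?K" "\<forall>y\<in>?K. m \<le> y"
    using compact_attains_inf[OF K(1) False] by blast
  obtain M where M: "M \<in> ?K" "\<forall>y\<in>?K. y \<le> M"
    using compact_attains_sup[OF K(1) False] by blast
  have mM: "0 < m" "m \<le> M" using m M K(2) by auto
  have zero: "\<phi> x = 0" if "x < m \<or> M < x" for x
  proof (rule ccontr)
    assume "\<phi> x \<noteq> 0"
    then have "x \<in> ?K" using closure_subset[of "{x. \<phi> x \<noteq> 0}"] by blast
    then show False using m M that by force
  qed
  show ?thesis
    by (rule that[of "m/2" "M+1"]) (use mM zero in auto)
qed

lemma continuous_on_test_function:
  "\<phi> \<in> test_functions \<Longrightarrow> continuous_on S \<phi>"
  by (meson DERIV_isCont continuous_at_imp_continuous_on test_functions_has_derivative)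

lemma integrable_halfline_of_support:
  fixes f :: "real \<Rightarrow> real"
  assumes "0 < a" "continuous_on {a..b} f" "\<And>x. x \<notin> {a..b} \<Longrightarrow> f x = 0"
  shows "integrable (lebesgue_on {0<..}) f"
proof -
  have "f absolutely_integrable_on {a..b}"
    using assms by (intro absolutely_integrable_continuous_real)
  moreover have "(\<lambda>x. indicator {0<..} x *\<^sub>R f x) = (\<lambda>x. indicator {a..b} x *\<^sub>R f x)"
    using assms by (auto simp: indicator_def fun_eq_iff)
  ultimately show ?thesis
    by (simp add: integrable_restrict_space set_integrable_def)
qed

lemma L1_loc_continuous:
  assumes "continuous_on {0<..} u"
  shows "u \<in> L1_loc"
proof -
  have "u absolutely_integrable_on K" if K: "compact K" "K \<subseteq> {0<..}" for K
  proof -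
    have "integrable lborel (\<lambda>x. indicator K x *\<^sub>R u x)"
      using K assms by (intro borel_integrable_compact) (auto intro: continuous_on_subset)
    then show ?thesis
      unfolding set_integrable_def
      using borel_measurable_integrable integrable_completion by blast
  qed
  then show ?thesis by (simp add: L1_loc_def)
qed

text \<open>
  The test function confines both integrals to a compact interval inside the half-line, so this is
  integration by parts there; behaviour of \<open>u\<close> near \<open>0\<close> and
  \<open>\<infinity>\<close> never enters.
\<close>

lemma has_weak_deriv_classical:
  assumes du: "\<And>r. r > 0 \<Longrightarrow> (u has_real_derivative v r) (at r)"
    and cv: "continuous_on {0<..} v"
  shows "has_weak_deriv 1 u v"
proof -
  have cu: "continuous_on {0<..} u"
    by (intro continuous_at_imp_continuous_on) (auto intro: DERIV_isCont[OF du])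
  have "integral\<^sup>L (lebesgue_on {0<..}) (\<lambda>r. u r * deriv \<phi> r) =
        - integral\<^sup>L (lebesgue_on {0<..}) (\<lambda>r. v r * \<phi> r)" if \<phi>: "\<phi> \<in> test_functions" for \<phi>
  proof -
    obtain a b where ab: "0 < a" "a < b" and z: "\<And>x. x \<notin> {a..b} \<Longrightarrow> \<phi> x = 0"
      and zab: "\<phi> a = 0" "\<phi> b = 0"
      using test_functions_support[OF \<phi>] by blast
    have sub: "{a..b} \<subseteq> {0<..}" using ab by auto
    have zd: "deriv \<phi> x = 0" if "x \<notin> {a..b}" for x
    proof -
      have "eventually (\<lambda>y. y \<in> - {a..b}) (nhds x)"
        using that by (intro eventually_nhds_in_open) auto
      then have "eventually (\<lambda>y. \<phi> y = 0) (nhds x)"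
        by (rule eventually_mono) (use z in auto)
      then have "deriv \<phi> x = deriv (\<lambda>_. 0) x"
        by (intro deriv_cong_ev) auto
      then show ?thesis by simp
    qed
    note d\<phi> = test_functions_deriv[OF \<phi>]
    have i1: "integrable (lebesgue_on {0<..}) (\<lambda>r. u r * deriv \<phi> r)"
      by (rule integrable_halfline_of_support[OF ab(1)])
        (use cu zd sub in \<open>auto intro!: continuous_intros continuous_on_test_function[OF d\<phi>]
          intro: continuous_on_subset\<close>)
    have i2: "integrable (lebesgue_on {0<..}) (\<lambda>r. v r * \<phi> r)"
      by (rule integrable_halfline_of_support[OF ab(1)])
        (use cv z sub in \<open>auto intro!: continuous_intros continuous_on_test_function[OF \<phi>]
          intro: continuous_on_subset\<close>)
    have "((\<lambda>r. u r * deriv \<phi> r + v r * \<phi> r) has_integral (u b * \<phi> b - u a * \<phi> a)) {a..b}"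
    proof (rule fundamental_theorem_of_calculus)
      fix x assume x: "x \<in> {a..b}"
      then have "x > 0" using ab by auto
      then have "((\<lambda>r. u r * \<phi> r) has_real_derivative (u x * deriv \<phi> x + v x * \<phi> x)) (at x)"
        by (auto intro!: derivative_eq_intros du test_functions_has_derivative[OF \<phi>])
      then show "((\<lambda>r. u r * \<phi> r) has_vector_derivative (u x * deriv \<phi> x + v x * \<phi> x))
          (at x within {a..b})"
        by (simp add: has_real_derivative_iff_has_vector_derivative has_vector_derivative_at_within)
    qed (use ab in auto)
    then have "((\<lambda>r. u r * deriv \<phi> r + v r * \<phi> r) has_integral 0) {a..b}"
      by (simp add: zab)
    then have "((\<lambda>r. u r * deriv \<phi> r + v r * \<phi> r) has_integral 0) {0<..}"
      by (rule has_integral_on_superset) (use z zd sub in auto)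
    then have "integral\<^sup>L (lebesgue_on {0<..}) (\<lambda>r. u r * deriv \<phi> r + v r * \<phi> r) = 0"
      by (subst lebesgue_integral_eq_integral) (use i1 i2 in auto)
    then show ?thesis using i1 i2 by simp
  qed
  then show ?thesis
    using L1_loc_continuous[OF cu] L1_loc_continuous[OF cv] by (simp add: has_weak_deriv_def)
qed

text \<open>
  Weak derivatives can be composed because a derivative of a test function is again a test function.
\<close>

lemma has_weak_deriv_Suc:
  assumes "has_weak_deriv 1 u v" "has_weak_deriv j v w"
  shows "has_weak_deriv (Suc j) u w"
  using assms test_functions_iterated_deriv unfolding has_weak_deriv_def by auto

section \<open>Growth of the truncated exponential series\<close>

text \<open>
  The exponential series without its first \<open>p - 1\<close> terms, \<open>p\<close> real, still grows
  like the full exponential. Termwise \<open>exp_p p' = exp_p p + s powr (p - 2) / Gamma (p - 1)\<close>, by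
  the functional equation of the Gamma function; hence \<open>exp_p p s * exp (- s)\<close> is
  nondecreasing. A bound with a loss of any positive power of \<open>s\<close> would not be enough below:
  the whole gain in the first limit is a power of \<open>s\<close>.
\<close>

lemma exp_p_lower_bound:
  fixes p s :: real
  assumes p: "p > 1" and s: "s \<ge> 1"
  shows "exp_p p 1 > 0" "exp_p p s \<ge> exp (s - 1) * exp_p p 1"
proof -
  define c where "c = (\<lambda>j. 1 / Gamma (p + real j))"
  define G where "G = (\<lambda>x. \<Sum>j. c j * x ^ j)"
  have cpos: "c j > 0" for j
    unfolding c_def using p by (auto intro!: divide_pos_pos Gamma_real_pos)
  have rec: "c j = (p + real j) * c (Suc j)" for j
  proof -
    have "p + real j > 0" using p by simp
    then have "Gamma (p + real j + 1) = (p + real j) * Gamma (p + real j)"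
      by (intro Gamma_plus1) (auto dest: nonpos_Ints_nonpos)
    then show ?thesis
      using \<open>p + real j > 0\<close> by (simp add: c_def add_ac)
  qed
  have summ: "summable (\<lambda>j. c j * x ^ j)" for x
  proof (rule summable_ratio_test[where c = "1/2" and N = "nat \<lceil>2 * \<bar>x\<bar>\<rceil>"])
    fix n assume "n \<ge> nat \<lceil>2 * \<bar>x\<bar>\<rceil>"
    then have n: "real n \<ge> 2 * \<bar>x\<bar>" by linarith
    have "2 * (\<bar>x\<bar> * c (Suc n)) \<le> (p + real n) * c (Suc n)"
      using n p cpos[of "Suc n"] by (simp add: mult.assoc[symmetric] mult_right_mono)
    then have "2 * (\<bar>x\<bar> * c (Suc n)) \<le> c n" by (simp add: rec[of n])
    then have "2 * (\<bar>x\<bar> * c (Suc n)) * \<bar>x\<bar> ^ n \<le> c n * \<bar>x\<bar> ^ n"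
      by (intro mult_right_mono) auto
    then show "norm (c (Suc n) * x ^ Suc n) \<le> 1 / 2 * norm (c n * x ^ n)"
      using cpos[of n] cpos[of "Suc n"] by (simp add: abs_mult power_abs mult_ac)
  qed auto
  have expG: "exp_p p x = x powr (p - 1) * G x" if "x > 0" for x
  proof -
    have "exp_p p x = (\<Sum>j. x powr (p - 1) * (c j * x ^ j))"
      unfolding exp_p_def c_def using that
      by (intro suminf_cong) (simp add: powr_add powr_realpow)
    also have "\<dots> = x powr (p - 1) * G x"
      unfolding G_def by (rule suminf_mult[OF summ])
    finally show ?thesis .
  qed
  have dG: "(G has_real_derivative (\<Sum>j. diffs c j * x ^ j)) (at x)" for x
    unfolding G_def by (rule termdiffs_strong_converges_everywhere[OF summ])
  \<comment> \<open>Multiplied by \<open>x powr (p - 2)\<close>, this is \<open>exp_p p' \<ge> exp_p p\<close>; what is dropped is the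
    term \<open>(p - 1) * c 0\<close>.\<close>
  have ode: "(p - 1) * G x + x * (\<Sum>j. diffs c j * x ^ j) \<ge> x * G x" for x
  proof -
    have s1: "summable (\<lambda>j. diffs c j * x ^ j)"
      by (rule termdiff_converges_all[OF summ])
    have s2: "summable (\<lambda>j. c (Suc j) * x ^ Suc j)"
      using summ[of x] summable_Suc_iff[of "\<lambda>j. c j * x ^ j"] by simp
    have "G x = c 0 + (\<Sum>j. c (Suc j) * x ^ Suc j)"
      unfolding G_def using suminf_split_head[OF summ[of x]] by simp
    then have "(p - 1) * G x = (p - 1) * c 0 + (\<Sum>j. (p - 1) * (c (Suc j) * x ^ Suc j))"
      by (simp only: suminf_mult[OF s2] distrib_left)
    then have "(p - 1) * G x + x * (\<Sum>j. diffs c j * x ^ j) =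
        (p - 1) * c 0 + ((\<Sum>j. (p - 1) * (c (Suc j) * x ^ Suc j)) + (\<Sum>j. x * (diffs c j * x ^ j)))"
      by (simp only: suminf_mult[OF s1] add.assoc)
    also have "\<dots> = (p - 1) * c 0 + (\<Sum>j. (p - 1) * (c (Suc j) * x ^ Suc j) + x * (diffs c j * x ^ j))"
      by (subst suminf_add[OF summable_mult[OF s2] summable_mult[OF s1]]) simp
    also have "(\<lambda>j. (p - 1) * (c (Suc j) * x ^ Suc j) + x * (diffs c j * x ^ j)) = (\<lambda>j. x * (c j * x ^ j))"
    proof
      fix j
      show "(p - 1) * (c (Suc j) * x ^ Suc j) + x * (diffs c j * x ^ j) = x * (c j * x ^ j)"
        by (subst rec[of j]) (simp add: diffs_def algebra_simps)
    qed
    also have "(\<Sum>j. x * (c j * x ^ j)) = x * G x"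
      unfolding G_def by (rule suminf_mult[OF summ])
    finally show ?thesis using p cpos[of 0] by simp
  qed
  define h where "h = (\<lambda>x. x powr (p - 1) * G x * exp (- x))"
  have "h 1 \<le> h s"
  proof (rule DERIV_nonneg_imp_nondecreasing[OF s])
    fix x :: real assume "1 \<le> x"
    let ?D = "\<Sum>j. diffs c j * x ^ j"
    have "x powr ((p - 2) + 1) = x powr (p - 2) * x powr 1"
      by (rule powr_add)
    then have e: "x powr (p - 1) = x powr (p - 2) * x"
      using \<open>1 \<le> x\<close> by simp
    have "((\<lambda>x. x powr (p - 1)) has_real_derivative (p - 1) * x powr (p - 1 - 1)) (at x)"
      using \<open>1 \<le> x\<close> by (intro has_real_derivative_powr) simp
    moreover have "((\<lambda>x. exp (- x)) has_real_derivative - exp (- x)) (at x)"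
      by (auto intro!: derivative_eq_intros)
    ultimately have "(h has_real_derivative
        ((p - 1) * x powr (p - 1 - 1) * G x + ?D * x powr (p - 1)) * exp (- x) +
        - exp (- x) * (x powr (p - 1) * G x)) (at x)"
      unfolding h_def by (intro DERIV_mult dG)
    moreover have "((p - 1) * x powr (p - 1 - 1) * G x + ?D * x powr (p - 1)) * exp (- x) +
        - exp (- x) * (x powr (p - 1) * G x) =
        x powr (p - 2) * exp (- x) * ((p - 1) * G x + x * ?D - x * G x)"
      unfolding e by (simp add: algebra_simps)
    ultimately have "(h has_real_derivative
        x powr (p - 2) * exp (- x) * ((p - 1) * G x + x * ?D - x * G x)) (at x)"
      by simp
    moreover have "x powr (p - 2) * exp (- x) * ((p - 1) * G x + x * ?D - x * G x) \<ge> 0"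
      using ode[of x] by simp
    ultimately show "\<exists>y. (h has_real_derivative y) (at x) \<and> y \<ge> 0" by blast
  qed
  then have "exp_p p 1 * exp (- 1) \<le> exp_p p s * exp (- s)"
    using s by (simp add: h_def expG)
  then have "exp_p p 1 * exp (- 1) * exp s \<le> exp_p p s * exp (- s) * exp s"
    by (intro mult_right_mono) auto
  then show "exp_p p s \<ge> exp (s - 1) * exp_p p 1"
    by (simp add: exp_minus exp_diff field_simps)
  have "G 1 > 0"
    unfolding G_def using cpos by (intro suminf_pos summ) auto
  then show "exp_p p 1 > 0" by (simp add: expG)
qed

section \<open>Spline ramps\<close>

text \<open>
  A ramp is a \<open>C\<^sup>k\<close> function that vanishes for \<open>t \<le> 0\<close> and is affine
  with slope \<open>1\<close> for \<open>t > k\<close>. It is a spline: the \<open>k\<close>-fold backward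
  difference of a truncated power of degree \<open>k + 1\<close>, since each difference lowers the degree of
  the polynomial part by one.
\<close>

definition trunc_power :: "nat \<Rightarrow> real \<Rightarrow> real" where
  "trunc_power d t = (max 0 t) ^ d / fact d"

definition bdiff :: "(real \<Rightarrow> real) \<Rightarrow> real \<Rightarrow> real" where
  "bdiff f t = f t - f (t - 1)"

text \<open>
  The \<open>i\<close>-th derivative of the ramp: differentiation lowers the degree of the truncated power
  and commutes with differences. The last index, \<open>i = k\<close>, has a truncated power of degree
  \<open>1\<close>, which is still continuous.
\<close>

definition ramp :: "nat \<Rightarrow> nat \<Rightarrow> real \<Rightarrow> real" where
  "ramp k i = (bdiff ^^ k) (trunc_power (Suc k - i))"

lemma trunc_power_has_derivative:
  "(trunc_power (Suc (Suc d)) has_real_derivative trunc_power (Suc d) t) (at t)"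
proof (cases "t = 0")
  case False
  have ev: "eventually (\<lambda>x. x \<in> (if t < 0 then {..<0} else {0<..})) (nhds t)"
    using False by (intro eventually_nhds_in_open) auto
  show ?thesis
  proof (cases "t < 0")
    case True
    have "eventually (\<lambda>x. trunc_power (Suc (Suc d)) x = 0) (nhds t)"
      using ev by eventually_elim (use True in \<open>auto simp: trunc_power_def\<close>)
    moreover have "trunc_power (Suc d) t = 0" using True by (simp add: trunc_power_def)
    ultimately show ?thesis
      by (subst DERIV_cong_ev[OF refl]) auto
  next
    case False
    have "eventually (\<lambda>x. trunc_power (Suc (Suc d)) x = x ^ Suc (Suc d) / fact (Suc (Suc d))) (nhds t)"
      using ev by eventually_elim (use False in \<open>auto simp: trunc_power_def\<close>)
    moreover have "((\<lambda>x. x ^ Suc (Suc d) / fact (Suc (Suc d))) has_real_derivative trunc_power (Suc d) t) (at t)"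
    proof -
      have "((\<lambda>x. x ^ Suc (Suc d) / fact (Suc (Suc d))) has_real_derivative
          real (Suc (Suc d)) * t ^ Suc d / fact (Suc (Suc d))) (at t)"
        using DERIV_cdivide[OF DERIV_pow[of "Suc (Suc d)" t UNIV], of "fact (Suc (Suc d))"]
        by (simp only: diff_Suc_Suc diff_zero)
      moreover have "real (Suc (Suc d)) * t ^ Suc d / fact (Suc (Suc d)) = trunc_power (Suc d) t"
        using False unfolding fact_Suc[of "Suc d"] trunc_power_def
        by (subst mult_divide_mult_cancel_left) auto
      ultimately show ?thesis by (simp only:)
    qed
    ultimately show ?thesis
      by (subst DERIV_cong_ev[OF refl]) auto
  qed
next
  case True
  have "((\<lambda>h. trunc_power (Suc (Suc d)) h / h) \<longlongrightarrow> 0) (at 0)"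
  proof (rule Lim_null_comparison)
    show "eventually (\<lambda>h. norm (trunc_power (Suc (Suc d)) h / h) \<le> \<bar>h\<bar> ^ Suc d) (at 0)"
    proof (rule eventually_mono[OF eventually_at_topological[THEN iffD2]])
      fix h :: real assume "h \<noteq> 0"
      have "\<bar>h\<bar> ^ Suc (Suc d) / fact (Suc (Suc d)) \<le> \<bar>h\<bar> ^ Suc (Suc d) / 1"
        by (intro divide_left_mono fact_ge_1) (auto simp del: fact_Suc)
      then have "\<bar>trunc_power (Suc (Suc d)) h\<bar> \<le> \<bar>h\<bar> ^ Suc (Suc d)"
        by (auto simp: trunc_power_def max_def simp del: fact_Suc power_Suc)
      then show "norm (trunc_power (Suc (Suc d)) h / h) \<le> \<bar>h\<bar> ^ Suc d"
        using \<open>h \<noteq> 0\<close> by (simp add: field_simps abs_mult)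
    qed auto
    show "((\<lambda>h::real. \<bar>h\<bar> ^ Suc d) \<longlongrightarrow> 0) (at 0)"
      by (auto intro!: tendsto_eq_intros)
  qed
  then show ?thesis
    using True by (simp add: DERIV_def trunc_power_def)
qed

lemma bdiff_iterate_Suc:
  "(bdiff ^^ Suc k) f t = (bdiff ^^ k) f t - (bdiff ^^ k) f (t - 1)"
  by (simp add: bdiff_def)

lemma bdiff_iterate_has_derivative:
  assumes "\<And>t. (f has_real_derivative g t) (at t)"
  shows "((bdiff ^^ k) f has_real_derivative (bdiff ^^ k) g t) (at t)"
proof (induction k arbitrary: t)
  case 0
  then show ?case using assms by simp
next
  case (Suc k)
  have "((\<lambda>t. (bdiff ^^ k) f (t - 1)) has_real_derivative (bdiff ^^ k) g (t - 1) * 1) (at t)"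
    by (rule DERIV_chain2[OF Suc.IH]) (auto intro!: derivative_eq_intros)
  then show ?case
    using DERIV_diff[OF Suc.IH] by (simp add: bdiff_def[abs_def])
qed

lemma bdiff_iterate_continuous:
  assumes "continuous_on UNIV f"
  shows "continuous_on UNIV ((bdiff ^^ k) f)"
proof (induction k)
  case 0
  then show ?case using assms by simp
next
  case (Suc k)
  have "continuous_on UNIV (\<lambda>t. (bdiff ^^ k) f (t - 1))"
    by (rule continuous_on_compose2[OF Suc]) (auto intro!: continuous_intros)
  then show ?case
    using Suc by (auto simp: bdiff_def[abs_def] intro!: continuous_intros)
qed

lemma bdiff_iterate_zero:
  assumes "\<And>t. t \<le> 0 \<Longrightarrow> f t = (0::real)" "t \<le> 0"
  shows "(bdiff ^^ k) f t = 0"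
  using assms(2) by (induction k arbitrary: t) (auto simp: assms bdiff_def)

text \<open>
  A difference of a function whose derivative is \<open>1\<close> on the whole step equals \<open>1\<close>,
  by the mean value theorem; the induction hypothesis supplies that derivative.
\<close>

lemma bdiff_trunc_power_eq_1:
  assumes "t \<ge> real (Suc d)"
  shows "(bdiff ^^ Suc d) (trunc_power (Suc d)) t = 1"
  using assms
proof (induction d arbitrary: t)
  case 0
  then show ?case by (simp add: bdiff_def trunc_power_def)
next
  case (Suc d)
  let ?h = "(bdiff ^^ Suc d) (trunc_power (Suc (Suc d)))"
  have "\<exists>z. z > t - 1 \<and> z < t \<and> ?h t - ?h (t - 1) = (t - (t - 1)) * (bdiff ^^ Suc d) (trunc_power (Suc d)) z"
    by (rule MVT2) (auto intro!: bdiff_iterate_has_derivative trunc_power_has_derivative simp del: funpow.simps)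
  then obtain z where z: "z > t - 1" "?h t - ?h (t - 1) = (bdiff ^^ Suc d) (trunc_power (Suc d)) z"
    by auto
  have "(bdiff ^^ Suc d) (trunc_power (Suc d)) z = 1"
    using z(1) Suc.prems by (intro Suc.IH) auto
  then show ?case using z(2) by (simp only: bdiff_iterate_Suc[of "Suc d"])
qed

lemma ramp_has_derivative:
  assumes "i < k"
  shows "(ramp k i has_real_derivative ramp k (Suc i) t) (at t)"
proof -
  obtain d where "k = Suc (i + d)" using assms less_iff_Suc_add by blast
  then show ?thesis
    unfolding ramp_def
    by (intro bdiff_iterate_has_derivative) (simp add: Suc_diff_le trunc_power_has_derivative)
qed

lemma continuous_on_ramp: "continuous_on S (ramp k i)"
proof -
  have "continuous_on UNIV (ramp k i)"
    unfolding ramp_def trunc_power_def[abs_def]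
    by (intro bdiff_iterate_continuous) (auto intro!: continuous_intros)
  then show ?thesis by (rule continuous_on_subset) simp
qed

lemma ramp_nonpos: "i \<le> k \<Longrightarrow> t \<le> 0 \<Longrightarrow> ramp k i t = 0"
  unfolding ramp_def by (rule bdiff_iterate_zero) (simp_all add: trunc_power_def max_absorb1)

lemma ramp_slope: "k \<ge> 1 \<Longrightarrow> t \<ge> real k \<Longrightarrow> ramp k 1 t = 1"
  using bdiff_trunc_power_eq_1[of "k - 1" t] by (simp add: ramp_def)

lemma ramp_affine:
  assumes "k \<ge> 1" "t \<ge> real k" "s \<ge> real k"
  shows "ramp k 0 t - ramp k 0 s = t - s"
proof -
  have "((\<lambda>t. ramp k 0 t - t) has_real_derivative 0) (at x within {real k..})"
    if "x \<in> {real k..}" for x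
  proof -
    have "(ramp k 0 has_real_derivative 1) (at x)"
      using ramp_has_derivative[of 0 k x] ramp_slope[of k x] assms(1) that by simp
    then have "((\<lambda>t. ramp k 0 t - t) has_real_derivative 1 - 1) (at x)"
      by (intro DERIV_diff DERIV_ident)
    then show ?thesis by (simp add: has_field_derivative_at_within)
  qed
  then have "\<exists>c. \<forall>x\<in>{real k..}. ramp k 0 x - x = c"
    by (intro has_field_derivative_zero_constant) auto
  then obtain c where "\<And>x. x \<ge> real k \<Longrightarrow> ramp k 0 x - x = c" by auto
  from this[OF assms(2)] this[OF assms(3)] show ?thesis by simp
qed

text \<open>
  All derivatives of the function \<open>ramp k 1\<close>, which is constant there.
\<close>

lemma ramp_higher_derivs_vanish:
  assumes "t > real k" "2 \<le> i" "i \<le> k"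
  shows "ramp k i t = 0"
proof -
  have "\<forall>t>real k. ramp k (Suc (Suc j)) t = 0" if "Suc (Suc j) \<le> k" for j
    using that
  proof (induction j)
    case 0
    have "ramp k 2 t = 0" if "t > real k" for t
    proof -
      have ev: "eventually (\<lambda>x. x \<in> {real k<..}) (nhds t)"
        using that by (intro eventually_nhds_in_open) auto
      have "eventually (\<lambda>x. ramp k 1 x = 1) (nhds t)"
        using ev by eventually_elim (use 0 in \<open>intro ramp_slope, auto\<close>)
      then have "(ramp k 1 has_real_derivative 0) (at t)"
        by (subst DERIV_cong_ev[OF refl]) auto
      with ramp_has_derivative[of 1 k t] 0 show ?thesis
        by (auto dest: DERIV_unique simp: numeral_2_eq_2)
    qed
    then show ?case by (simp add: numeral_2_eq_2)
  next
    case (Suc j)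
    show ?case
    proof (intro allI impI)
      fix t assume "t > real k"
      then have ev: "eventually (\<lambda>x. x \<in> {real k<..}) (nhds t)"
        by (intro eventually_nhds_in_open) auto
      have "eventually (\<lambda>x. ramp k (Suc (Suc j)) x = 0) (nhds t)"
        using ev by eventually_elim (use Suc in auto)
      then have "(ramp k (Suc (Suc j)) has_real_derivative 0) (at t)"
        by (subst DERIV_cong_ev[OF refl]) auto
      with ramp_has_derivative[of "Suc (Suc j)" k t] Suc.prems
      show "ramp k (Suc (Suc (Suc j))) t = 0" by (auto dest: DERIV_unique)
    qed
  qed
  from this[of "i - 2"] assms show ?thesis by (simp add: Suc_diff_Suc numeral_2_eq_2)
qed

section \<open>Symbols of the iterated operators\<close>

text \<open>
  The operator \<open>Q(D)\<close> applied to a profile; the argument \<open>U\<close> lists the derivatives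
  of the profile, \<open>U 0\<close> being the profile itself. Since only the indices \<open>i \<le>
  k\<close> are summed, this is meant for polynomials of degree at most \<open>k\<close>.
\<close>

definition diffop :: "nat \<Rightarrow> (nat \<Rightarrow> real \<Rightarrow> real) \<Rightarrow> real poly \<Rightarrow> real \<Rightarrow> real" where
  "diffop k U Q t = (\<Sum>i\<le>k. coeff Q i * U i t)"

text \<open>
  With \<open>r = exp (- t)\<close>, \<open>a = \<gamma> - 1\<close> and \<open>\<tau> = \<theta> + 2 -
  \<gamma>\<close>, the operator \<open>L\<close> maps \<open>exp (j \<tau> t) f(t)\<close> to \<open>exp
  ((j + 1) \<tau> t) (a - j \<tau> - D)(j \<tau> + D) f\<close>. Thus, up to an exponential factor,
  \<open>L\<^sup>m\<close> has constant coefficients, and these are its symbol.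
\<close>

primrec L_symbol :: "real \<Rightarrow> real \<Rightarrow> nat \<Rightarrow> real poly" where
  "L_symbol a \<tau> 0 = 1"
| "L_symbol a \<tau> (Suc m) =
     [:a - real m * \<tau>, - 1:] * ([:real m * \<tau>, 1:] * L_symbol a \<tau> m)"

text \<open>
  In the odd case the outer derivative contributes \<open>- (m \<tau> + D)\<close>, where \<open>m = k div
  2\<close>, and a factor \<open>exp t\<close>.
\<close>

definition nabla_symbol :: "real \<Rightarrow> real \<Rightarrow> nat \<Rightarrow> real poly" where
  "nabla_symbol a \<tau> k =
     (if even k then L_symbol a \<tau> (k div 2)
      else [:- (real (k div 2) * \<tau>), - 1:] * L_symbol a \<tau> (k div 2))"

lemma degree_L_symbol: "degree (L_symbol a \<tau> m) \<le> 2 * m"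
proof (induction m)
  case (Suc m)
  have "degree (L_symbol a \<tau> (Suc m)) \<le>
      degree [:a - real m * \<tau>, - 1:] + (degree [:real m * \<tau>, 1:] + degree (L_symbol a \<tau> m))"
    unfolding L_symbol.simps by (rule order_trans[OF degree_mult_le add_left_mono[OF degree_mult_le]])
  then show ?case using Suc by simp
qed simp

lemma coeff_0_L_symbol: "m \<ge> 1 \<Longrightarrow> coeff (L_symbol a \<tau> m) 0 = 0"
  by (induction m) (auto simp: coeff_mult_0 le_Suc_eq)

text \<open>
  The factor \<open>j = 0\<close> is \<open>(a - X) X\<close>, so the linear coefficient of the product is
  \<open>a\<close> times the values at \<open>0\<close> of the factors with \<open>j \<ge> 1\<close>.
\<close>

lemma coeff_1_L_symbol:
  "coeff (L_symbol a \<tau> (Suc m)) 1 = a * (\<Prod>j=1..m. (a - real j * \<tau>) * (real j * \<tau>))"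
proof (induction m)
  case (Suc m)
  have "coeff (L_symbol a \<tau> (Suc (Suc m))) 1 =
      (a - real (Suc m) * \<tau>) * (real (Suc m) * \<tau>) * coeff (L_symbol a \<tau> (Suc m)) 1"
    unfolding L_symbol.simps(2)[of a \<tau> "Suc m"]
    using coeff_0_L_symbol[of "Suc m" a \<tau>] by (simp add: coeff_pCons del: L_symbol.simps)
  then show ?case using Suc by (simp add: mult_ac)
qed simp

text \<open>
  Constants are annihilated by \<open>\<nabla>\<^sub>L\<^sup>k\<close>. Therefore a plateau of the profile
  costs nothing.
\<close>

lemma coeff_0_nabla_symbol: "k \<ge> 1 \<Longrightarrow> coeff (nabla_symbol a \<tau> k) 0 = 0"
  using coeff_0_L_symbol[of "k div 2" a \<tau>]
  by (cases "k = 1") (auto simp: nabla_symbol_def coeff_mult_0 Suc_le_eq div_greater_zero_iff)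

lemma Gamma_descending:
  fixes x :: real
  assumes "x > real m"
  shows "Gamma x / Gamma (x - real m) = (\<Prod>j=1..m. x - real j)"
  using assms
proof (induction m)
  case 0
  then show ?case by (simp add: Gamma_real_pos less_imp_neq[OF Gamma_real_pos, symmetric])
next
  case (Suc m)
  have pos: "x - real (Suc m) > 0" using Suc.prems by simp
  then have "Gamma (x - real (Suc m) + 1) = (x - real (Suc m)) * Gamma (x - real (Suc m))"
    by (intro Gamma_plus1) (auto dest: nonpos_Ints_nonpos)
  then have "Gamma (x - real m) = (x - real (Suc m)) * Gamma (x - real (Suc m))"
    by (simp add: algebra_simps)
  then have "Gamma x / Gamma (x - real (Suc m)) = Gamma x / Gamma (x - real m) * (x - real (Suc m))"
    using pos by simp
  also have "Gamma x / Gamma (x - real m) = (\<Prod>j=1..m. x - real j)"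
    using Suc by simp
  finally show ?case by simp
qed

lemma abs_coeff_1_L_symbol:
  assumes "\<tau> > 0" "a > real m * \<tau>"
  shows "\<bar>coeff (L_symbol a \<tau> (Suc m)) 1\<bar> =
    a * \<tau> ^ (2 * m) * (fact m * (Gamma (a / \<tau>) / Gamma (a / \<tau> - real m)))"
proof -
  have *: "a - real j * \<tau> = \<tau> * (a / \<tau> - real j)" for j
    using assms by (simp add: field_simps)
  have pos: "a / \<tau> - real j > 0" if "j \<le> m" for j
  proof -
    have "real m < a / \<tau>" using assms by (simp add: field_simps)
    then show ?thesis using that by linarith
  qed
  have "(\<Prod>j=1..m. (a - real j * \<tau>) * (real j * \<tau>)) =
      (\<Prod>j=1..m. \<tau>\<^sup>2 * (real j * (a / \<tau> - real j)))"
    unfolding * by (intro prod.cong refl) (simp add: power2_eq_square mult_ac)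
  also have "\<dots> = \<tau> ^ (2 * m) * (fact m * (\<Prod>j=1..m. a / \<tau> - real j))"
    by (simp add: prod.distrib power_mult fact_prod)
  also have "(\<Prod>j=1..m. a / \<tau> - real j) = Gamma (a / \<tau>) / Gamma (a / \<tau> - real m)"
    using pos[of m] by (intro Gamma_descending[symmetric]) simp
  finally have "coeff (L_symbol a \<tau> (Suc m)) 1 =
      a * \<tau> ^ (2 * m) * (fact m * (Gamma (a / \<tau>) / Gamma (a / \<tau> - real m)))"
    by (simp only: coeff_1_L_symbol mult.assoc)
  moreover have "a > 0"
    using assms by (meson le_less_trans less_eq_real_def mult_nonneg_nonneg of_nat_0_le_iff)
  moreover have "Gamma (a / \<tau>) > 0" "Gamma (a / \<tau> - real m) > 0"
    using pos[of 0] pos[of m] by (auto intro: Gamma_real_pos)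
  ultimately show ?thesis using assms by simp
qed

text \<open>
  Here the sharp constant gets its meaning: \<open>beta0\<close> is \<open>\<eta> + 1\<close> times a power
  of the factor by which \<open>\<nabla>\<^sub>L\<^sup>k\<close>, up to sign and a power of
  \<open>r\<close>, multiplies the slope of a profile that is affine in \<open>t\<close>. The lower bound on
  \<open>a\<close> keeps every \<open>a - j \<tau>\<close> with \<open>1 \<le> j < k div 2\<close> positive,
  so that this factor does not vanish.
\<close>

lemma beta0_eq_symbol:
  fixes \<theta> \<gamma> :: real
  defines "\<tau> \<equiv> \<theta> + 2 - \<gamma>" and "a \<equiv> \<gamma> - 1"
  assumes k: "k \<ge> 1" and \<tau>: "\<tau> > 0" and a: "a > 0" "a > real (k div 2) * \<tau> - \<tau>"
  shows "beta0 k p \<eta> \<theta> \<gamma> = (\<eta> + 1) * \<bar>coeff (nabla_symbol a \<tau> k) 1\<bar> powr (p / (p - 1))"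
    and "coeff (nabla_symbol a \<tau> k) 1 \<noteq> 0"
proof -
  have "\<bar>coeff (nabla_symbol a \<tau> k) 1\<bar> =
      (if even k then a * \<tau> powi (int k - 2) *
          (Gamma (real k / 2) * Gamma (a / \<tau>) / Gamma (a / \<tau> - (real k - 2) / 2))
       else a * \<tau> powi (int k - 2) *
          (Gamma ((real k + 1) / 2) * Gamma (a / \<tau>) / Gamma (a / \<tau> - (real k - 3) / 2))) \<and>
    coeff (nabla_symbol a \<tau> k) 1 \<noteq> 0"
  \<comment> \<open>For \<open>k = 1\<close> the symbol is \<open>- X\<close>, and \<open>beta0\<close> contains the quotient
    \<open>Gamma x / Gamma (x + 1) = 1 / x\<close> with \<open>x = a / \<tau>\<close>, outside the pattern of descending
    products.\<close>
  proof (cases "k = 1")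
    case True
    have "a / \<tau> > 0" using \<tau> a by simp
    then have "Gamma (a / \<tau> + 1) = a / \<tau> * Gamma (a / \<tau>)"
      by (intro Gamma_plus1) (auto dest: nonpos_Ints_nonpos)
    moreover have nz: "Gamma (a / \<tau>) \<noteq> 0"
      using Gamma_real_pos[OF \<open>a / \<tau> > 0\<close>] by simp
    ultimately have "a / \<tau> * (Gamma (a / \<tau>) / Gamma (a / \<tau> + 1)) = 1"
      using \<tau> a by simp
    then have "a * inverse \<tau> * (Gamma (a / \<tau>) / Gamma (a / \<tau> + 1)) = 1"
      by (simp only: divide_inverse)
    then show ?thesis
      using True nz \<tau> a by (simp add: nabla_symbol_def power_int_minus)
  next
    case False
    define m where "m = k div 2 - 1"
    have m: "k div 2 = Suc m" using False k by (simp add: m_def)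
    have am: "a > real m * \<tau>" using a(2) by (simp add: m algebra_simps)
    note c = abs_coeff_1_L_symbol[OF \<tau> am]
    have "real m < a / \<tau>" using am \<tau> by (simp add: field_simps)
    then have "Gamma (a / \<tau>) > 0" "Gamma (a / \<tau> - real m) > 0"
      by (auto intro: Gamma_real_pos)
    then have "a * \<tau> ^ (2 * m) * (fact m * (Gamma (a / \<tau>) / Gamma (a / \<tau> - real m))) > 0"
      using a(1) \<tau> by (intro mult_pos_pos divide_pos_pos zero_less_power) simp_all
    then have nz: "coeff (L_symbol a \<tau> (Suc m)) 1 \<noteq> 0"
      using c by linarith
    show ?thesis
    proof (cases "even k")
      case True
      then have k: "k = 2 * m + 2" using m by (auto elim!: evenE)
      have e: "real k / 2 = 1 + real m" "(real k - 2) / 2 = real m" "int k - 2 = int (2 * m)"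
        using k by auto
      then show ?thesis
        using True m c nz unfolding e
        by (simp add: nabla_symbol_def Gamma_fact mult_ac power_int_of_nat[symmetric]
            del: L_symbol.simps power_int_of_nat)
    next
      case odd: False
      then have k: "k = 2 * m + 3" using m by (auto elim!: oddE)
      have e: "(real k + 1) / 2 = 1 + real (Suc m)" "(real k - 3) / 2 = real m"
        "int k - 2 = int (2 * m + 1)"
        using k by auto
      have \<Gamma>: "Gamma (1 + real (Suc m)) = real (Suc m) * fact m"
        by (simp only: Gamma_fact fact_Suc)
      have "coeff (nabla_symbol a \<tau> k) 1 = - (real (Suc m) * \<tau>) * coeff (L_symbol a \<tau> (Suc m)) 1"
        using odd m coeff_0_L_symbol[of "Suc m" a \<tau>]
        by (simp add: nabla_symbol_def coeff_pCons del: L_symbol.simps)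
      then have "\<bar>coeff (nabla_symbol a \<tau> k) 1\<bar> =
          real (Suc m) * \<tau> * (a * \<tau> ^ (2 * m) * (fact m * (Gamma (a / \<tau>) / Gamma (a / \<tau> - real m))))"
        and "coeff (nabla_symbol a \<tau> k) 1 \<noteq> 0"
        using c nz \<tau> by (simp_all add: abs_mult del: L_symbol.simps)
      then show ?thesis
        using odd unfolding e \<Gamma>
        by (simp add: mult_ac power_int_of_nat[symmetric] power_int_add
            del: power_int_of_nat)
    qed
  qed
  then show "beta0 k p \<eta> \<theta> \<gamma> = (\<eta> + 1) * \<bar>coeff (nabla_symbol a \<tau> k) 1\<bar> powr (p / (p - 1))"
    and "coeff (nabla_symbol a \<tau> k) 1 \<noteq> 0"
    by (auto simp: beta0_def \<tau>_def[symmetric] a_def[symmetric])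
qed

section \<open>Functions of the logarithmic variable\<close>

lemma nn_integral_halfline:
  fixes f :: "real \<Rightarrow> real"
  assumes "S \<subseteq> {0<..}" "\<And>x. x \<in> S \<Longrightarrow> 0 \<le> f x" "(f has_integral I) S"
  shows "(\<integral>\<^sup>+ r. ennreal (f r) * indicator S r \<partial>lebesgue_on {0<..}) = ennreal I"
proof -
  have "(\<integral>\<^sup>+ r. ennreal (f r) * indicator S r \<partial>lebesgue_on {0<..}) =
        (\<integral>\<^sup>+ r. ennreal (f r) * indicator S r * indicator {0<..} r \<partial>lebesgue)"
    by (rule nn_integral_restrict_space) simp
  also have "\<dots> = (\<integral>\<^sup>+ r. ennreal (f r) * indicator S r \<partial>lborel)"
    unfolding nn_integral_completion
    by (intro nn_integral_cong) (use assms(1) in \<open>auto simp: indicator_def\<close>)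
  also have "\<dots> = ennreal I"
    using assms(2,3) by (rule nn_integral_has_integral_lebesgue')
  finally show ?thesis .
qed

text \<open>
  A \<open>C\<^sup>k\<close> profile \<open>U 0\<close> on the line, with its derivatives \<open>U 1,
  \<dots>, U k\<close>, all vanishing outside a compact interval. In the variable \<open>r = exp (-
  t)\<close> it becomes a function supported in a compact subset of \<open>(0,\<infinity>)\<close>, so that
  every weight is harmless, whatever its exponent.
\<close>

locale compact_profile =
  fixes k :: nat and U :: "nat \<Rightarrow> real \<Rightarrow> real" and lo hi :: real
  assumes deriv_U: "\<And>i t. i < k \<Longrightarrow> (U i has_real_derivative U (Suc i) t) (at t)"
    and cont_U: "\<And>i. i \<le> k \<Longrightarrow> continuous_on UNIV (U i)"
    and support_U: "\<And>i t. i \<le> k \<Longrightarrow> t \<notin> {lo..hi} \<Longrightarrow> U i t = 0"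
begin

text \<open>
  The class of functions that is closed under all the operations in \<open>\<nabla>\<^sub>L\<^sup>k\<close>:
  multiplication by a power of \<open>r\<close> changes \<open>b\<close>, and \<open>d/dr\<close> acts as
  \<open>r powr (- 1) * (b - D)\<close> on the remaining factor.
\<close>

definition radial :: "real \<Rightarrow> real poly \<Rightarrow> real \<Rightarrow> real" where
  "radial b Q r = r powr b * diffop k U Q (- ln r)"

lemma diffop_support: "t \<notin> {lo..hi} \<Longrightarrow> diffop k U Q t = 0"
  unfolding diffop_def by (intro sum.neutral) (auto simp: support_U)

lemma radial_support:
  assumes "r > 0" "r \<notin> {exp (- hi)..exp (- lo)}"
  shows "radial b Q r = 0"
proof -
  have "- ln r \<notin> {lo..hi}"
  proof
    assume "- ln r \<in> {lo..hi}"
    then have "- hi \<le> ln r" "ln r \<le> - lo" by auto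
    then have "exp (- hi) \<le> exp (ln r)" "exp (ln r) \<le> exp (- lo)" by (simp_all only: exp_le_cancel_iff)
    then show False using assms by auto
  qed
  then show ?thesis by (simp add: radial_def diffop_support)
qed

lemma continuous_on_radial: "continuous_on {0<..} (radial b Q)"
proof -
  have "continuous_on {0<..} (\<lambda>r. U i (- ln r))" if "i \<le> k" for i
    by (rule continuous_on_compose2[OF cont_U[OF that]]) (auto intro!: continuous_intros)
  then show ?thesis
    unfolding radial_def[abs_def] diffop_def
    by (auto intro!: continuous_intros)
qed

lemma diffop_has_derivative:
  assumes "degree Q < k"
  shows "(diffop k U Q has_real_derivative diffop k U (pCons 0 Q) t) (at t)"
proof -
  have "(diffop k U Q has_real_derivative (\<Sum>i<k. coeff Q i * U (Suc i) t)) (at t)"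
  proof -
    have "diffop k U Q = (\<lambda>t. \<Sum>i<k. coeff Q i * U i t)"
      using assms
      by (auto simp: diffop_def[abs_def] lessThan_Suc_atMost[symmetric] coeff_eq_0)
    then show ?thesis
      by (auto intro!: derivative_eq_intros deriv_U sum.cong)
  qed
  also have "(\<Sum>i<k. coeff Q i * U (Suc i) t) = diffop k U (pCons 0 Q) t"
    unfolding diffop_def by (subst sum.atMost_shift) simp
  finally show ?thesis .
qed

lemma diffop_linear_factor:
  "diffop k U ([:b, c:] * Q) t = b * diffop k U Q t + c * diffop k U (pCons 0 Q) t"
proof -
  have "[:b, c:] * Q = smult b Q + smult c (pCons 0 Q)" by simp
  then show ?thesis
    by (simp only: diffop_def coeff_add coeff_smult distrib_right sum.distrib mult.assoc
        sum_distrib_left)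
qed

lemma radial_has_derivative:
  assumes "degree Q < k" "r > 0"
  shows "(radial b Q has_real_derivative radial (b - 1) ([:b, - 1:] * Q) r) (at r)"
proof -
  have "((\<lambda>r. diffop k U Q (- ln r)) has_real_derivative
      diffop k U (pCons 0 Q) (- ln r) * (- (1 / r))) (at r)"
    by (rule DERIV_chain2[OF diffop_has_derivative])
      (use assms in \<open>auto intro!: derivative_eq_intros\<close>)
  then have "(radial b Q has_real_derivative
      b * r powr (b - 1) * diffop k U Q (- ln r) +
      diffop k U (pCons 0 Q) (- ln r) * (- (1 / r)) * r powr b) (at r)"
    unfolding radial_def[abs_def] by (intro DERIV_mult has_real_derivative_powr assms)
  also have "b * r powr (b - 1) * diffop k U Q (- ln r) +
      diffop k U (pCons 0 Q) (- ln r) * (- (1 / r)) * r powr b =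
      radial (b - 1) ([:b, - 1:] * Q) r"
    unfolding radial_def diffop_linear_factor using assms by (simp add: powr_diff field_simps)
  finally show ?thesis .
qed

lemma radial_weak_deriv:
  assumes "degree Q < k"
  shows "has_weak_deriv 1 (radial b Q) (radial (b - 1) ([:b, - 1:] * Q))"
  by (intro has_weak_deriv_classical radial_has_derivative assms continuous_on_radial)

lemma degree_linear_factor_le: "degree ([:b, c:] * Q) \<le> Suc (degree (Q :: real poly))"
  using degree_mult_le[of "[:b, c:]" Q] by (simp split: if_splits)

lemma radial_weak_deriv_iterate:
  assumes "degree Q + j \<le> k"
  shows "\<exists>Q'. has_weak_deriv j (radial b Q) (radial (b - real j) Q')"
  using assms
proof (induction j arbitrary: b Q)
  case 0
  show ?case
    by (rule exI[of _ Q])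
      (auto simp: has_weak_deriv_def intro: L1_loc_continuous continuous_on_radial)
next
  case (Suc j)
  have "degree ([:b, - 1:] * Q) + j \<le> k"
    using Suc.prems degree_linear_factor_le[of b "- 1" Q] by simp
  from Suc.IH[OF this, of "b - 1"] obtain Q' where
    Q': "has_weak_deriv j (radial (b - 1) ([:b, - 1:] * Q)) (radial (b - 1 - real j) Q')" by blast
  have "has_weak_deriv 1 (radial b Q) (radial (b - 1) ([:b, - 1:] * Q))"
    using Suc.prems by (intro radial_weak_deriv) simp
  from has_weak_deriv_Suc[OF this Q'] show ?case
    by (auto simp: algebra_simps)
qed

lemma radial_in_Lp_weighted:
  assumes "p > 0"
  shows "radial b Q \<in> Lp_weighted p a"
proof -
  let ?I = "{exp (- hi)..exp (- lo)}"
  let ?f = "\<lambda>r. \<bar>radial b Q r\<bar> powr p * r powr a"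
  have sub: "?I \<subseteq> {0<..}"
  proof
    fix r assume "r \<in> ?I"
    then have "exp (- hi) \<le> r" by simp
    then show "r \<in> {0<..}" using exp_gt_zero[of "- hi"] by (simp only: greaterThan_iff)
  qed
  have "continuous_on ?I ?f"
    using sub assms
    by (auto intro!: continuous_intros continuous_on_powr' continuous_on_subset[OF continuous_on_radial])
  then have "(?f has_integral (integral ?I ?f)) ?I"
    by (intro integrable_integral integrable_continuous_real)
  then have "(\<integral>\<^sup>+ r. ennreal (?f r) * indicator ?I r \<partial>lebesgue_on {0<..}) = ennreal (integral ?I ?f)"
    using sub by (intro nn_integral_halfline) auto
  moreover have "(\<integral>\<^sup>+ r. ennreal (?f r) * indicator ?I r \<partial>lebesgue_on {0<..}) =
      (\<integral>\<^sup>+ r. ennreal (?f r) \<partial>lebesgue_on {0<..})"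
    by (intro nn_integral_cong) (auto simp: indicator_def radial_support)
  ultimately have "(\<integral>\<^sup>+ r. ennreal (?f r) \<partial>lebesgue_on {0<..}) < \<infinity>" by simp
  then have "wnorm p a (radial b Q) < \<infinity>" by (simp add: wnorm_def epowr_def)
  moreover have "radial b Q \<in> borel_measurable (lebesgue_on {0<..})"
    by (intro continuous_imp_measurable_on_sets_lebesgue continuous_on_radial) auto
  ultimately show ?thesis by (simp add: Lp_weighted_def)
qed

lemma radial_in_X_space:
  assumes "p > 0"
  shows "radial 0 1 \<in> X_space k p \<alpha>"
proof -
  have "\<exists>v. has_weak_deriv j (radial 0 1) v \<and> v \<in> Lp_weighted p (\<alpha> j)" if "j \<in> {1..k}" for j
    using radial_weak_deriv_iterate[of 1 j 0] that radial_in_Lp_weighted[OF assms] by auto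
  then show ?thesis using radial_in_Lp_weighted[OF assms] by (simp add: X_space_def)
qed

text \<open>
  Differentiating gives the factor \<open>b - X\<close>, multiplying by \<open>r powr \<gamma>\<close> and
  differentiating again the factor \<open>b - 1 + \<gamma> - X\<close>; the minus sign of \<open>L\<close>
  is moved into the first of them.
\<close>

lemma radial_has_L:
  assumes "degree Q + 2 \<le> k"
  shows "has_L \<theta> \<gamma> (radial b Q)
    (radial (b - (\<theta> + 2 - \<gamma>)) ([:\<gamma> - 1 + b, - 1:] * ([:- b, 1:] * Q)))"
proof -
  let ?Q1 = "[:b, - 1:] * Q"
  let ?Q2 = "[:b - 1 + \<gamma>, - 1:] * ?Q1"
  have w1: "has_weak_deriv 1 (radial b Q) (radial (b - 1) ?Q1)"
    using assms by (intro radial_weak_deriv) simp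
  have eq: "(\<lambda>r. r powr \<gamma> * radial (b - 1) ?Q1 r) = radial (b - 1 + \<gamma>) ?Q1"
    by (simp add: fun_eq_iff radial_def powr_add mult_ac)
  have "has_weak_deriv 1 (radial (b - 1 + \<gamma>) ?Q1) (radial (b - 1 + \<gamma> - 1) ?Q2)"
    using assms degree_linear_factor_le[of b "- 1" Q] by (intro radial_weak_deriv) simp
  then have w2: "has_weak_deriv 1 (\<lambda>r. r powr \<gamma> * radial (b - 1) ?Q1 r)
      (radial (b - 1 + \<gamma> - 1) ?Q2)"
    by (simp only: eq)
  have w3: "radial (b - (\<theta> + 2 - \<gamma>)) ([:\<gamma> - 1 + b, - 1:] * ([:- b, 1:] * Q)) r =
      - (r powr - \<theta>) * radial (b - 1 + \<gamma> - 1) ?Q2 r" for r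
  proof -
    have "[:- b, 1:] = - [:b, - 1:]" by simp
    then have "[:\<gamma> - 1 + b, - 1:] * ([:- b, 1:] * Q) = - ?Q2"
      by (simp only: add_ac diff_conv_add_uminus mult_minus_left mult_minus_right)
    moreover have "diffop k U (- ?Q2) t = - diffop k U ?Q2 t" for t
      by (simp add: diffop_def sum_negf del: mult_pCons_left mult_pCons_right)
    moreover have "r powr (b - (\<theta> + 2 - \<gamma>)) = r powr - \<theta> * r powr (b - 1 + \<gamma> - 1)"
      unfolding powr_add[symmetric] by (simp add: algebra_simps)
    ultimately show ?thesis by (simp only: radial_def)
  qed
  show ?thesis
    unfolding has_L_def using w1 w2 w3 by blast
qed

lemma radial_has_L_power:
  assumes "2 * m \<le> k"
  shows "has_L_power \<theta> \<gamma> m (radial 0 1)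
    (radial (- (real m * (\<theta> + 2 - \<gamma>))) (L_symbol (\<gamma> - 1) (\<theta> + 2 - \<gamma>) m))"
  using assms
proof (induction m)
  case 0
  then show ?case by simp
next
  case (Suc m)
  let ?\<tau> = "\<theta> + 2 - \<gamma>"
  have "has_L \<theta> \<gamma> (radial (- (real m * ?\<tau>)) (L_symbol (\<gamma> - 1) ?\<tau> m))
    (radial (- (real m * ?\<tau>) - ?\<tau>) ([:\<gamma> - 1 + (- (real m * ?\<tau>)), - 1:] *
      ([:- (- (real m * ?\<tau>)), 1:] * L_symbol (\<gamma> - 1) ?\<tau> m)))"
    using degree_L_symbol[of "\<gamma> - 1" ?\<tau> m] Suc.prems by (intro radial_has_L) simp
  moreover have "(- (real m * ?\<tau>)) - ?\<tau> = - (real (Suc m) * ?\<tau>)"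
    by (simp add: algebra_simps)
  moreover have "has_L_power \<theta> \<gamma> m (radial 0 1) (radial (- (real m * ?\<tau>)) (L_symbol (\<gamma> - 1) ?\<tau> m))"
    using Suc by simp
  ultimately show ?case
    unfolding has_L_power.simps L_symbol.simps by (metis diff_conv_add_uminus minus_minus)
qed

lemma radial_has_nabla_L:
  "has_nabla_L \<theta> \<gamma> k (radial 0 1)
    (radial (- (real (k div 2) * (\<theta> + 2 - \<gamma>)) - (if even k then 0 else 1))
      (nabla_symbol (\<gamma> - 1) (\<theta> + 2 - \<gamma>) k))"
proof -
  note p = radial_has_L_power[of "k div 2" \<theta> \<gamma>]
  show ?thesis
  proof (cases "even k")
    case True
    then show ?thesis using p by (simp add: has_nabla_L_def nabla_symbol_def)
  next
    case False
    let ?b = "- (real (k div 2) * (\<theta> + 2 - \<gamma>))"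
    have "degree (L_symbol (\<gamma> - 1) (\<theta> + 2 - \<gamma>) (k div 2)) < k"
      using degree_L_symbol[of "\<gamma> - 1" "\<theta> + 2 - \<gamma>" "k div 2"] False by (auto elim!: oddE)
    from radial_weak_deriv[OF this, of ?b]
    have "has_weak_deriv 1 (radial ?b (L_symbol (\<gamma> - 1) (\<theta> + 2 - \<gamma>) (k div 2)))
        (radial (?b - 1) (nabla_symbol (\<gamma> - 1) (\<theta> + 2 - \<gamma>) k))"
      using False by (simp add: nabla_symbol_def)
    moreover have "(k - 1) div 2 = k div 2" using False by (auto elim!: oddE)
    ultimately show ?thesis using False p unfolding has_nabla_L_def by auto
  qed
qed

end

section \<open>The smoothed trapezoid\<close>

text \<open>
  The profile is a smoothed trapezoid: it rises with slope \<open>1\<close> over a length \<open>T\<close>,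
  stays at height \<open>T\<close> long enough to contain an interval of length \<open>1\<close>, and comes
  down with slope \<open>- 1 / N\<close> over a length \<open>N T\<close>. The descent makes the support
  compact; its cost in \<open>L\<^sup>p\<close> is a multiple of \<open>N powr (- p) * N * T\<close>, which
  is bounded for \<open>N = T powr (1 / (p - 1))\<close>. The offset \<open>T + k + 1\<close> is the end of
  the plateau: the rise, started at \<open>0\<close>, is stopped by the second ramp between \<open>T\<close>
  and \<open>T + k\<close>.
\<close>

definition trapezoid :: "nat \<Rightarrow> real \<Rightarrow> real \<Rightarrow> nat \<Rightarrow> real \<Rightarrow> real" where
  "trapezoid k T N i t =
     ramp k i t - ramp k i (t - T) -
     (ramp k i (t - (T + real k + 1)) - ramp k i (t - (T + real k + 1 + N * T))) / N"

lemma trapezoid_has_derivative: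
  assumes "i < k"
  shows "(trapezoid k T N i has_real_derivative trapezoid k T N (Suc i) t) (at t)"
proof -
  have shift: "((\<lambda>t. ramp k i (t - s)) has_real_derivative ramp k (Suc i) (t - s)) (at t)" for s
  proof -
    have "((\<lambda>t. t - s) has_real_derivative 1) (at t)"
      by (auto intro!: derivative_eq_intros)
    from DERIV_chain2[OF ramp_has_derivative[OF assms] this] show ?thesis by simp
  qed
  show ?thesis
    unfolding trapezoid_def[abs_def]
    by (intro DERIV_diff DERIV_cdivide shift ramp_has_derivative assms)
qed

lemma continuous_on_trapezoid: "continuous_on UNIV (trapezoid k T N i)"
proof -
  have "continuous_on UNIV (\<lambda>t. ramp k i (t - s))" for s
    by (rule continuous_on_compose2[OF continuous_on_ramp]) (auto intro!: continuous_intros)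
  then show ?thesis
    unfolding trapezoid_def[abs_def] divide_inverse
    by (intro continuous_on_diff continuous_on_mult continuous_on_const continuous_on_ramp)
qed

lemma trapezoid_nonpos: "i \<le> k \<Longrightarrow> t \<le> 0 \<Longrightarrow> T \<ge> 0 \<Longrightarrow> N \<ge> 0 \<Longrightarrow> trapezoid k T N i t = 0"
proof -
  assume a: "i \<le> k" "t \<le> 0" "T \<ge> 0" "N \<ge> 0"
  then have "N * T \<ge> 0" by simp
  then have "t - T \<le> 0" "t - (T + real k + 1) \<le> 0" "t - (T + real k + 1 + N * T) \<le> 0"
    using a by linarith+
  then show ?thesis using a by (simp only: trapezoid_def ramp_nonpos) simp
qed

lemma trapezoid_beyond:
  assumes "k \<ge> 1" "i \<le> k" "t > T + 2 * real k + 1 + N * T" "T > 0" "N > 0"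
  shows "trapezoid k T N i t = 0"
proof -
  have "N * T > 0" using assms by simp
  then have *: "t > real k" "t - T > real k" "t - (T + real k + 1) > real k"
    "t - (T + real k + 1 + N * T) > real k"
    using assms by linarith+
  consider "i = 0" | "i = 1" | "i \<ge> 2" by linarith
  then show ?thesis
  proof cases
    case 1
    have "ramp k 0 t - ramp k 0 (t - T) = T"
      "ramp k 0 (t - (T + real k + 1)) - ramp k 0 (t - (T + real k + 1 + N * T)) = N * T"
      using * assms(1) by (simp_all only: ramp_affine[OF assms(1) less_imp_le less_imp_le])
    then show ?thesis using 1 assms by (simp only: trapezoid_def) simp
  next
    case 2
    then show ?thesis using * assms(1) ramp_slope[OF assms(1) less_imp_le]
      by (simp add: trapezoid_def)
  next
    case 3
    then show ?thesis using * assms(2) by (simp add: trapezoid_def ramp_higher_derivs_vanish)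
  qed
qed

lemma trapezoid_plateau:
  assumes "k \<ge> 1" "T \<ge> 0" "N \<ge> 0" "T + real k \<le> t" "t \<le> T + real k + 1"
  shows "trapezoid k T N 0 t = T"
proof -
  have "N * T \<ge> 0" using assms by simp
  then have "ramp k 0 (t - (T + real k + 1)) = 0" "ramp k 0 (t - (T + real k + 1 + N * T)) = 0"
    using assms by (intro ramp_nonpos; linarith)+
  moreover have "ramp k 0 t - ramp k 0 (t - T) = t - (t - T)"
    using assms by (intro ramp_affine) linarith+
  ultimately show ?thesis by (simp add: trapezoid_def)
qed

lemma diffop_ramp_nonpos: "t \<le> 0 \<Longrightarrow> diffop k (ramp k) Q t = 0"
  unfolding diffop_def by (intro sum.neutral) (auto simp: ramp_nonpos)

lemma diffop_ramp_flat:
  assumes "k \<ge> 1" "coeff Q 0 = 0" "t > real k"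
  shows "diffop k (ramp k) Q t = coeff Q 1"
proof -
  have "diffop k (ramp k) Q t = (\<Sum>i\<le>k. if i = 1 then coeff Q 1 else 0)"
    unfolding diffop_def
  proof (intro sum.cong refl)
    fix i assume "i \<in> {..k}"
    then consider "i = 0" | "i = 1" | "2 \<le> i" "i \<le> k" by fastforce
    then show "coeff Q i * ramp k i t = (if i = 1 then coeff Q 1 else 0)"
      using assms ramp_slope[of k t] ramp_higher_derivs_vanish[of k t i] by cases auto
  qed
  also have "\<dots> = coeff Q 1" using assms(1) by (simp add: sum.delta)
  finally show ?thesis .
qed

lemma diffop_ramp_bounded:
  assumes "k \<ge> 1" "coeff Q 0 = 0"
  shows "\<exists>M\<ge>0. \<forall>t. \<bar>diffop k (ramp k) Q t\<bar> \<le> M"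
proof -
  have "continuous_on {0..real k} (diffop k (ramp k) Q)"
    unfolding diffop_def[abs_def]
    by (intro continuous_on_sum continuous_on_mult continuous_on_const continuous_on_ramp)
  then have "bounded (diffop k (ramp k) Q ` {0..real k})"
    by (intro compact_imp_bounded compact_continuous_image compact_Icc)
  then obtain M where M: "\<And>t. 0 \<le> t \<Longrightarrow> t \<le> real k \<Longrightarrow> \<bar>diffop k (ramp k) Q t\<bar> \<le> M"
    unfolding bounded_iff by (metis (no_types, lifting) atLeastAtMost_iff image_eqI real_norm_def)
  show ?thesis
  proof (intro exI[of _ "max M \<bar>coeff Q 1\<bar>"] conjI allI)
    fix t
    consider "t \<le> 0" | "0 \<le> t" "t \<le> real k" | "real k < t" by linarith
    then show "\<bar>diffop k (ramp k) Q t\<bar> \<le> max M \<bar>coeff Q 1\<bar>"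
      by cases (simp_all only: diffop_ramp_nonpos diffop_ramp_flat[OF assms] max.coboundedI1[OF M]
          max.cobounded2 abs_zero max.coboundedI2 abs_ge_zero)
  qed auto
qed

lemma diffop_trapezoid:
  "diffop k (trapezoid k T N) Q t =
     diffop k (ramp k) Q t - diffop k (ramp k) Q (t - T) -
     (diffop k (ramp k) Q (t - (T + real k + 1)) -
      diffop k (ramp k) Q (t - (T + real k + 1 + N * T))) / N"
  by (simp add: diffop_def trapezoid_def right_diff_distrib sum_subtractf sum_divide_distrib
      diff_divide_distrib)

lemma abs_diffop_trapezoid_le:
  assumes M: "\<And>t. \<bar>diffop k (ramp k) Q t\<bar> \<le> M" and N: "N \<ge> 1"
  shows "\<bar>diffop k (trapezoid k T N) Q t\<bar> \<le> 4 * M"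
proof -
  let ?G = "diffop k (ramp k) Q"
  have "\<bar>(?G x - ?G y) / N\<bar> \<le> 2 * M" for x y
  proof -
    have "\<bar>(?G x - ?G y) / N\<bar> \<le> \<bar>?G x - ?G y\<bar>"
      using N by (simp add: abs_divide divide_le_eq mult_right_le_one_le mult_left_mono[of 1 N, simplified])
    then show ?thesis using M[of x] M[of y] by linarith
  qed
  from this[of "t - (T + real k + 1)" "t - (T + real k + 1 + N * T)"] M[of t] M[of "t - T"]
  show ?thesis unfolding diffop_trapezoid by linarith
qed

definition step_sum :: "(real \<times> real \<times> real) list \<Rightarrow> real \<Rightarrow> real" where
  "step_sum L t = (\<Sum>(c, x, y)\<leftarrow>L. c * indicator {x..y} t)"

lemma borel_measurable_step_sum [measurable]: "step_sum L \<in> borel_measurable borel"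
  unfolding step_sum_def[abs_def] by (induction L) (auto split: prod.split)

lemma measurable_halfline:
  "f \<in> borel_measurable borel \<Longrightarrow> f \<in> borel_measurable (lebesgue_on {0<..})"
  for f :: "real \<Rightarrow> ennreal"
  by (intro measurable_restrict_space1 measurable_completion) simp

text \<open>
  Since \<open>dr / r = - dt\<close>, the integral over \<open>(0,\<infinity>)\<close> against \<open>dr /
  r\<close> of a step function of \<open>t = - ln r\<close> is its ordinary integral over the line. This
  replaces a general change of variables.
\<close>

lemma nn_integral_step_sum:
  assumes "\<forall>(c, x, y) \<in> set L. 0 \<le> c \<and> x \<le> y"
  shows "(\<integral>\<^sup>+ r. ennreal (step_sum L (- ln r) / r) \<partial>lebesgue_on {0<..}) =
    ennreal (\<Sum>(c, x, y)\<leftarrow>L. c * (y - x))"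
  using assms
proof (induction L)
  case Nil
  then show ?case by (simp add: step_sum_def)
next
  case (Cons cxy L)
  obtain c x y where cxy: "cxy = (c, x, y)" by (cases cxy)
  have c: "c \<ge> 0" "x \<le> y" using Cons.prems cxy by auto
  let ?S = "{exp (- y)..exp (- x)}"
  have sub: "?S \<subseteq> {0<..}"
    by (meson atLeastAtMost_iff exp_gt_zero greaterThan_iff less_le_trans subsetI)
  have nn: "step_sum L t \<ge> 0" "(\<Sum>(c, x, y)\<leftarrow>L. c * (y - x)) \<ge> 0" for t
    using Cons.prems unfolding step_sum_def
    by (force intro!: sum_list_nonneg mult_nonneg_nonneg)+
  have ind: "indicator {x..y} (- ln r) = (indicator ?S r :: real)" if "r > 0" for r
  proof -
    have "x \<le> - ln r \<longleftrightarrow> exp (ln r) \<le> exp (- x)" "- ln r \<le> y \<longleftrightarrow> exp (- y) \<le> exp (ln r)"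
      unfolding exp_le_cancel_iff by linarith+
    then have "x \<le> - ln r \<longleftrightarrow> r \<le> exp (- x)" "- ln r \<le> y \<longleftrightarrow> exp (- y) \<le> r"
      using that by (simp_all only: exp_ln)
    then show ?thesis by (auto simp: indicator_def)
  qed
  have meas: "(\<lambda>r. ennreal (step_sum L (- ln r) / r)) \<in> borel_measurable (lebesgue_on {0<..})"
    by (intro measurable_halfline) measurable
  have meas': "(\<lambda>r. ennreal (c / r) * indicator ?S r) \<in> borel_measurable (lebesgue_on {0<..})"
    by (intro measurable_halfline) measurable
  have "((\<lambda>r. c / r) has_integral (c * ln (exp (- x)) - c * ln (exp (- y)))) ?S"
  proof (rule fundamental_theorem_of_calculus)
    fix r assume "r \<in> ?S"
    then have "r > 0" using sub by auto
    then have "((\<lambda>r. c * ln r) has_real_derivative c / r) (at r)"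
      by (auto intro!: derivative_eq_intros)
    then show "((\<lambda>r. c * ln r) has_vector_derivative c / r) (at r within ?S)"
      by (simp add: has_real_derivative_iff_has_vector_derivative has_vector_derivative_at_within)
  qed (use c in simp)
  then have "((\<lambda>r. c / r) has_integral c * (y - x)) ?S" by (simp add: algebra_simps)
  then have 1: "(\<integral>\<^sup>+ r. ennreal (c / r) * indicator ?S r \<partial>lebesgue_on {0<..}) = ennreal (c * (y - x))"
    using sub c by (intro nn_integral_halfline) (auto intro!: divide_nonneg_nonneg dest: subsetD[OF sub])
  have "(\<integral>\<^sup>+ r. ennreal (step_sum (cxy # L) (- ln r) / r) \<partial>lebesgue_on {0<..}) =
      (\<integral>\<^sup>+ r. ennreal (c / r) * indicator ?S r + ennreal (step_sum L (- ln r) / r) \<partial>lebesgue_on {0<..})"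
  proof (intro nn_integral_cong)
    fix r :: real assume "r \<in> space (lebesgue_on {0<..})"
    then have r: "r > 0" by (simp add: space_restrict_space)
    have "step_sum (cxy # L) (- ln r) / r = c / r * indicator ?S r + step_sum L (- ln r) / r"
      by (simp add: step_sum_def cxy ind[OF r] add_divide_distrib)
    then show "ennreal (step_sum (cxy # L) (- ln r) / r) =
        ennreal (c / r) * indicator ?S r + ennreal (step_sum L (- ln r) / r)"
      using r c nn(1)[of "- ln r"] by (auto simp: indicator_def ennreal_plus)
  qed
  also have "\<dots> = ennreal (c * (y - x)) + ennreal (\<Sum>(c, x, y)\<leftarrow>L. c * (y - x))"
    using Cons by (subst nn_integral_add[OF meas' meas]) (simp add: 1)
  also have "\<dots> = ennreal (\<Sum>(c, x, y)\<leftarrow>cxy # L. c * (y - x))"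
    using nn c by (simp add: cxy)
  finally show ?case .
qed

text \<open>
  Away from the four transition intervals of length \<open>k\<close> the trapezoid is affine, so
  \<open>Q(D)\<close> sees only its slope, through \<open>coeff Q 1\<close>. On the transitions a bound
  independent of \<open>T\<close> and \<open>N\<close> is enough.
\<close>

lemma diffop_trapezoid_step_bound:
  fixes k Q and T N p :: real
  defines "c \<equiv> \<bar>coeff Q 1\<bar>" and "s \<equiv> T + real k + 1"
  assumes k: "k \<ge> 1" and Q: "coeff Q 0 = 0" and M: "\<And>t. \<bar>diffop k (ramp k) Q t\<bar> \<le> M"
    and T: "T \<ge> real k" and N: "N \<ge> 1" and p: "p > 0"
  shows "\<bar>diffop k (trapezoid k T N) Q t\<bar> powr p \<le>
    step_sum ([(c powr p, real k, T), ((c / N) powr p, s + real k, s + N * T)] @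
      map (\<lambda>x. ((4 * M) powr p, x, x + real k)) [0, T, s, s + N * T]) t"
proof -
  let ?G = "diffop k (ramp k) Q" and ?D = "diffop k (trapezoid k T N) Q"
  let ?J = "indicator {0..real k} t + indicator {T..T + real k} t +
        indicator {s..s + real k} t + indicator {s + N * T..s + N * T + real k} t :: real"
  let ?R = "c powr p * indicator {real k..T} t +
      (c / N) powr p * indicator {s + real k..s + N * T} t +
      (4 * M) powr p * ?J"
  have NT: "N * T \<ge> real k" using N T k mult_mono[of 1 N "real k" T] by simp
  have D: "?D t = ?G t - ?G (t - T) - (?G (t - s) - ?G (t - (s + N * T))) / N"
    unfolding diffop_trapezoid s_def ..
  have le: "\<bar>?D t\<bar> powr p \<le> (4 * M) powr p"
    using abs_diffop_trapezoid_le[OF M N] p by (intro powr_mono2) auto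
  have nn: "c powr p \<ge> 0" "(c / N) powr p \<ge> 0" "(4 * M) powr p \<ge> 0" by auto
  have tr: "\<bar>?D t\<bar> powr p \<le> ?R" if "1 \<le> ?J"
  proof -
    have "(4 * M) powr p * 1 \<le> (4 * M) powr p * ?J"
      using that by (intro mult_left_mono) auto
    moreover have "c powr p * indicator {real k..T} t \<ge> 0"
      "(c / N) powr p * indicator {s + real k..s + N * T} t \<ge> 0" by auto
    ultimately show ?thesis using le by linarith
  qed
  have z: "?G x = 0" if "x \<le> 0" for x using that by (rule diffop_ramp_nonpos)
  have fl: "?G x = coeff Q 1" if "x > real k" for x
    using diffop_ramp_flat[OF k Q that] .
  consider "t < 0" | "0 \<le> t" "t \<le> real k" | "real k < t" "t < T" | "T \<le> t" "t \<le> T + real k"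
    | "T + real k < t" "t < s" | "s \<le> t" "t \<le> s + real k" | "s + real k < t" "t < s + N * T"
    | "s + N * T \<le> t" "t \<le> s + N * T + real k" | "s + N * T + real k < t"
    by linarith
  then have "\<bar>?D t\<bar> powr p \<le> ?R"
  proof cases
    case 1
    then have "?D t = 0" using T NT unfolding D s_def by (simp add: z)
    then show ?thesis using nn by (auto intro!: add_nonneg_nonneg mult_nonneg_nonneg)
  next
    case 2
    then have "1 \<le> ?J" by (auto simp: indicator_def)
    then show ?thesis by (rule tr)
  next
    case 3
    then have "?D t = coeff Q 1" using T NT unfolding D s_def by (simp add: z fl)
    then show ?thesis using 3 nn by (auto simp: c_def indicator_def)
  next
    case 4
    then have "1 \<le> ?J" by (auto simp: indicator_def)
    then show ?thesis by (rule tr)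
  next
    case 5
    then have "?D t = 0" using T NT unfolding D s_def by (simp add: z fl)
    then show ?thesis using nn by (auto intro!: add_nonneg_nonneg mult_nonneg_nonneg)
  next
    case 6
    then have "1 \<le> ?J" by (auto simp: indicator_def)
    then show ?thesis by (rule tr)
  next
    case 7
    then have "?D t = - (coeff Q 1 / N)" using T NT unfolding D s_def by (simp add: z fl)
    then have "\<bar>?D t\<bar> = c / N" using N by (simp add: c_def)
    then show ?thesis using 7 nn by (auto simp: indicator_def)
  next
    case 8
    then have "1 \<le> ?J" by (auto simp: indicator_def)
    then show ?thesis by (rule tr)
  next
    case 9
    then have "?D t = 0" using T NT unfolding D s_def by (simp add: fl)
    then show ?thesis using nn by (auto intro!: add_nonneg_nonneg mult_nonneg_nonneg)
  qed
  also have "?R = step_sum ([(c powr p, real k, T), ((c / N) powr p, s + real k, s + N * T)] @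
      map (\<lambda>x. ((4 * M) powr p, x, x + real k)) [0, T, s, s + N * T]) t"
    by (simp add: step_sum_def algebra_simps)
  finally show ?thesis .
qed

section \<open>The normalised trapezoid\<close>

lemma wnorm_le_1:
  assumes "p > 0" "(\<integral>\<^sup>+ r. ennreal (\<bar>u r\<bar> powr p * r powr a) \<partial>lebesgue_on {0<..}) \<le> 1"
  shows "wnorm p a u \<le> 1"
proof -
  let ?I = "\<integral>\<^sup>+ r. ennreal (\<bar>u r\<bar> powr p * r powr a) \<partial>lebesgue_on {0<..}"
  have "?I < top" using assms(2) by (rule le_less_trans) simp
  moreover have "enn2real ?I \<le> 1" using enn2real_mono[OF assms(2)] by simp
  ultimately show ?thesis
    using assms(1) powr_le1[of "1 / p" "enn2real ?I"] by (auto simp: wnorm_def epowr_def)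
qed

lemma epowr_wnorm:
  assumes "p > 0"
  shows "epowr (wnorm p a u) p = (\<integral>\<^sup>+ r. ennreal (\<bar>u r\<bar> powr p * r powr a) \<partial>lebesgue_on {0<..})"
  using assms by (auto simp: wnorm_def epowr_def powr_powr less_top)

lemma wnorm_positive_finite:
  assumes "p > 0" "0 < (\<integral>\<^sup>+ r. ennreal (\<bar>u r\<bar> powr p * r powr a) \<partial>lebesgue_on {0<..})"
    "(\<integral>\<^sup>+ r. ennreal (\<bar>u r\<bar> powr p * r powr a) \<partial>lebesgue_on {0<..}) < \<infinity>"
  shows "0 < wnorm p a u" "wnorm p a u < \<infinity>"
proof -
  let ?I = "\<integral>\<^sup>+ r. ennreal (\<bar>u r\<bar> powr p * r powr a) \<partial>lebesgue_on {0<..}"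
  have "enn2real ?I > 0" using assms by (simp add: enn2real_positive_iff)
  then show "0 < wnorm p a u" "wnorm p a u < \<infinity>"
    using assms(3) by (auto simp: wnorm_def epowr_def)
qed

text \<open>
  A trapezoid of width \<open>T\<close> scaled by \<open>(c powr p * T + K) powr (- 1 / p)\<close>. The
  number \<open>c powr p * T\<close> is the contribution of a rise of length \<open>T\<close> to the
  \<open>p\<close>-th power of the norm, and \<open>K\<close>, which does not depend on \<open>T\<close>,
  pays for the descent and the four transitions. The linear bound in \<open>- ln r\<close> is what makes the
  norm of \<open>u\<close> with the weight \<open>r powr \<eta>\<close> small, and the last line describes
  the plateau.
\<close>

lemma concentrating_profile:
  fixes k :: nat and p \<theta> \<gamma> :: real and \<alpha> :: "nat \<Rightarrow> real"
  defines "c \<equiv> \<bar>coeff (nabla_symbol (\<gamma> - 1) (\<theta> + 2 - \<gamma>) k) 1\<bar>"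
  assumes k: "k \<ge> 1" and p: "p > 1" and \<alpha>: "\<alpha> k - real k * p + 1 = 0"
  shows "\<exists>K>0. \<exists>B\<ge>0. \<forall>T\<ge>max 1 (real k). \<exists>u \<in> X_space k p \<alpha>.
    (\<exists>v. has_nabla_L \<theta> \<gamma> k u v \<and> wnorm p (\<alpha> k + real (k div 2) * (\<theta> - \<gamma>) * p) v \<le> 1) \<and>
    (\<forall>r>0. \<bar>u r\<bar> \<le> (c powr p * T + K) powr (- 1 / p) * B * max 0 (- ln r)) \<and>
    (\<forall>r. exp (- (T + real k + 1)) \<le> r \<longrightarrow> r \<le> exp (- (T + real k)) \<longrightarrow>
      u r = (c powr p * T + K) powr (- 1 / p) * T)"
proof -
  define P where "P = nabla_symbol (\<gamma> - 1) (\<theta> + 2 - \<gamma>) k"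
  have P0: "coeff P 0 = 0" unfolding P_def using k by (rule coeff_0_nabla_symbol)
  obtain M where M: "\<And>t. \<bar>diffop k (ramp k) P t\<bar> \<le> M"
    using diffop_ramp_bounded[OF k P0] by blast
  have slope: "diffop k U [:0, 1:] t = U 1 t" for U t
  proof -
    have "diffop k U [:0, 1:] t = (\<Sum>i\<le>k. if i = 1 then U 1 t else 0)"
      unfolding diffop_def by (intro sum.cong refl) (auto simp: coeff_pCons split: nat.split)
    then show ?thesis using k by (simp add: sum.delta)
  qed
  obtain S where S0: "S \<ge> 0" and S: "\<And>t. \<bar>diffop k (ramp k) [:0, 1:] t\<bar> \<le> S"
    using diffop_ramp_bounded[OF k, of "[:0, 1:]"] by auto
  define K where "K = c powr p + 4 * (4 * M) powr p * real k + 1"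
  have K: "K > 0" unfolding K_def by (intro add_nonneg_pos add_nonneg_nonneg mult_nonneg_nonneg) auto
  have "\<exists>u \<in> X_space k p \<alpha>.
    (\<exists>v. has_nabla_L \<theta> \<gamma> k u v \<and> wnorm p (\<alpha> k + real (k div 2) * (\<theta> - \<gamma>) * p) v \<le> 1) \<and>
    (\<forall>r>0. \<bar>u r\<bar> \<le> (c powr p * T + K) powr (- 1 / p) * (4 * S) * max 0 (- ln r)) \<and>
    (\<forall>r. exp (- (T + real k + 1)) \<le> r \<longrightarrow> r \<le> exp (- (T + real k)) \<longrightarrow>
      u r = (c powr p * T + K) powr (- 1 / p) * T)" if T: "T \<ge> max 1 (real k)" for T
  proof -
    have T1: "T \<ge> 1" "T \<ge> real k" using T by auto
    define N where "N = T powr (1 / (p - 1))"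
    define l where "l = (c powr p * T + K) powr (- 1 / p)"
    define V where "V = (\<lambda>i t. l * trapezoid k T N i t)"
    define hi where "hi = T + 2 * real k + 1 + N * T"
    define s where "s = T + real k + 1"
    have N1: "N \<ge> 1" unfolding N_def using T1 p by (intro ge_one_powr_ge_zero) auto
    have pos: "c powr p * T + K > 0" using T1 K by (intro add_nonneg_pos) auto
    have l0: "l > 0" unfolding l_def using pos by simp
    have lp: "l powr p = 1 / (c powr p * T + K)"
      unfolding l_def powr_powr using p pos by (simp add: powr_minus_divide)
    interpret compact_profile k V 0 hi
    proof
      show "(V i has_real_derivative V (Suc i) t) (at t)" if "i < k" for i t
        unfolding V_def by (intro DERIV_cmult trapezoid_has_derivative that)
      show "continuous_on UNIV (V i)" for i
        unfolding V_def by (intro continuous_on_mult continuous_on_const continuous_on_trapezoid)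
      show "V i t = 0" if "i \<le> k" "t \<notin> {0..hi}" for i t
      proof -
        have "t \<le> 0 \<or> t > hi" using that by auto
        then show ?thesis
          using trapezoid_nonpos[of i k t T N] trapezoid_beyond[of k i T N t] that(1) k T1 N1
          by (auto simp: V_def hi_def)
      qed
    qed
    have scale: "diffop k V Q t = l * diffop k (trapezoid k T N) Q t" for Q t
      by (simp add: diffop_def V_def sum_distrib_left mult_ac)
    have u: "radial 0 1 r = l * trapezoid k T N 0 (- ln r)" if "r > 0" for r
    proof -
      have "diffop k V 1 (- ln r) = (\<Sum>i\<le>k. if i = 0 then V 0 (- ln r) else 0)"
        unfolding diffop_def by (intro sum.cong refl) simp
      then have "diffop k V 1 (- ln r) = V 0 (- ln r)" by (simp add: sum.delta)
      then show ?thesis using that by (simp add: radial_def) (simp add: V_def)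
    qed
    define b where "b = - (real (k div 2) * (\<theta> + 2 - \<gamma>)) - (if even k then 0 else 1)"
    define \<alpha>' where "\<alpha>' = \<alpha> k + real (k div 2) * (\<theta> - \<gamma>) * p"
    \<comment> \<open>The condition on \<open>\<alpha> k\<close> makes the weight exactly \<open>dr / r\<close>, that is, Lebesgue measure in \<open>t\<close>.\<close>
    have b: "b * p + \<alpha>' = - 1"
    proof -
      have "real k = 2 * real (k div 2) + (if even k then 0 else 1)"
        by (cases "even k") (auto elim!: evenE oddE)
      then have "\<alpha> k = (2 * real (k div 2) + (if even k then 0 else 1)) * p - 1"
        using \<alpha> by simp
      then show ?thesis unfolding b_def \<alpha>'_def by (simp add: algebra_simps)
    qed
    define L where "L = [(c powr p, real k, T), ((c / N) powr p, s + real k, s + N * T)] @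
      map (\<lambda>x. ((4 * M) powr p, x, x + real k)) [0, T, s, s + N * T]"
    have NT: "N * T \<ge> real k" using N1 T1 mult_mono[of 1 N "real k" T] by simp
    have "(\<integral>\<^sup>+ r. ennreal (\<bar>radial b P r\<bar> powr p * r powr \<alpha>') \<partial>lebesgue_on {0<..}) \<le>
        (\<integral>\<^sup>+ r. ennreal (l powr p) * ennreal (step_sum L (- ln r) / r) \<partial>lebesgue_on {0<..})"
    proof (intro nn_integral_mono)
      fix r :: real assume "r \<in> space (lebesgue_on {0<..})"
      then have r: "r > 0" by (simp add: space_restrict_space)
      let ?D = "diffop k (trapezoid k T N) P (- ln r)"
      have "r powr (b * p) * r powr \<alpha>' = 1 / r"
        using r by (simp add: powr_add[symmetric] b powr_minus_divide)
      moreover have "\<bar>radial b P r\<bar> powr p * r powr \<alpha>' =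
          l powr p * \<bar>?D\<bar> powr p * (r powr (b * p) * r powr \<alpha>')"
        using r l0 by (simp add: radial_def scale abs_mult powr_mult powr_powr mult_ac)
      ultimately have "\<bar>radial b P r\<bar> powr p * r powr \<alpha>' = l powr p * (\<bar>?D\<bar> powr p / r)"
        by simp
      also have "\<dots> \<le> l powr p * (step_sum L (- ln r) / r)"
        using diffop_trapezoid_step_bound[OF k P0 M T1(2) N1, of p "- ln r"] p r
        unfolding L_def c_def P_def s_def by (intro mult_left_mono divide_right_mono) auto
      finally show "ennreal (\<bar>radial b P r\<bar> powr p * r powr \<alpha>') \<le>
          ennreal (l powr p) * ennreal (step_sum L (- ln r) / r)"
        by (simp add: ennreal_mult'[symmetric] ennreal_leI)
    qed
    also have "\<dots> = ennreal (l powr p) * ennreal (\<Sum>(c, x, y)\<leftarrow>L. c * (y - x))"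
      using T1 NT
      by (subst nn_integral_cmult, intro measurable_halfline, measurable, subst nn_integral_step_sum)
        (auto simp: L_def)
    also have "\<dots> = ennreal (l powr p * (\<Sum>(c, x, y)\<leftarrow>L. c * (y - x)))"
      by (simp add: ennreal_mult')
    also have "\<dots> \<le> ennreal 1"
    proof (rule ennreal_leI)
      \<comment> \<open>The exponent in \<open>N\<close> is chosen for this identity: the descent costs as much as a rise of
        length \<open>1\<close>.\<close>
      have "N powr p = N * T"
      proof -
        have "N powr p = T powr (1 / (p - 1) * p)" by (simp add: N_def powr_powr)
        also have "1 / (p - 1) * p = 1 / (p - 1) + 1" using p by (simp add: field_simps)
        also have "T powr \<dots> = N * T" using T1 by (simp add: N_def powr_add)
        finally show ?thesis .
      qed
      then have "(c / N) powr p * (N * T) = c powr p"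
        using N1 T1 by (simp add: powr_divide c_def)
      moreover have "(c / N) powr p * (N * T - real k) \<le> (c / N) powr p * (N * T)"
        by (intro mult_left_mono) auto
      moreover have "c powr p * (T - real k) \<le> c powr p * T"
        by (intro mult_left_mono) auto
      moreover have "(\<Sum>(c, x, y)\<leftarrow>L. c * (y - x)) =
          c powr p * (T - real k) + (c / N) powr p * (N * T - real k) + 4 * (4 * M) powr p * real k"
        by (simp add: L_def algebra_simps)
      ultimately have "(\<Sum>(c, x, y)\<leftarrow>L. c * (y - x)) \<le> c powr p * T + K"
        unfolding K_def by linarith
      then show "l powr p * (\<Sum>(c, x, y)\<leftarrow>L. c * (y - x)) \<le> 1"
        using pos by (simp add: lp)
    qed
    finally have "wnorm p \<alpha>' (radial b P) \<le> 1"
      using p by (intro wnorm_le_1) auto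
    moreover have "has_nabla_L \<theta> \<gamma> k (radial 0 1) (radial b P)"
      unfolding b_def P_def by (rule radial_has_nabla_L)
    moreover have "radial 0 1 \<in> X_space k p \<alpha>" using p by (intro radial_in_X_space) simp
    moreover have "\<bar>radial 0 1 r\<bar> \<le> l * (4 * S) * max 0 (- ln r)" if r: "r > 0" for r
    proof -
      have "\<bar>trapezoid k T N 0 t\<bar> \<le> 4 * S * max 0 t" for t
      proof (cases "t \<le> 0")
        case True
        then show ?thesis using T1 N1 by (simp add: trapezoid_nonpos)
      next
        case False
        have "\<exists>z. z > 0 \<and> z < t \<and>
            trapezoid k T N 0 t - trapezoid k T N 0 0 = (t - 0) * trapezoid k T N (Suc 0) z"
          using False k by (intro MVT2 trapezoid_has_derivative) auto
        then obtain z where z: "trapezoid k T N 0 t = t * trapezoid k T N 1 z"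
          using T1 N1 by (auto simp: trapezoid_nonpos)
        have "\<bar>trapezoid k T N 1 z\<bar> \<le> 4 * S"
          using abs_diffop_trapezoid_le[OF S N1, of T z] by (simp only: slope)
        then show ?thesis
          using False mult_left_mono[of "\<bar>trapezoid k T N 1 z\<bar>" "4 * S" t]
          by (simp add: z abs_mult mult_ac)
      qed
      from this[of "- ln r"] show ?thesis
        using l0 r by (simp add: u abs_mult mult.assoc)
    qed
    moreover have "radial 0 1 r = l * T"
      if r: "exp (- (T + real k + 1)) \<le> r" "r \<le> exp (- (T + real k))" for r
    proof -
      have r0: "r > 0" using r(1) exp_gt_zero less_le_trans by blast
      have "exp (- (T + real k + 1)) \<le> exp (ln r)" "exp (ln r) \<le> exp (- (T + real k))"
        using r r0 by (simp_all only: exp_ln)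
      then have "T + real k \<le> - ln r" "- ln r \<le> T + real k + 1"
        unfolding exp_le_cancel_iff by linarith+
      then show ?thesis using k T1 N1 by (simp add: u[OF r0] trapezoid_plateau)
    qed
    ultimately show ?thesis unfolding l_def \<alpha>'_def by blast
  qed
  then show ?thesis using K S0 by (intro exI[of _ K] conjI exI[of _ "4 * S"]) auto
qed

section \<open>Integral estimates with a power weight\<close>

text \<open>
  The point is the scaling in \<open>A\<close>: the moment of \<open>(- ln r)\<^sup>p\<close> against
  \<open>r powr \<eta>\<close> over \<open>(0,1)\<close> is finite because the logarithm is dominated by a
  small negative power of \<open>r\<close>.
\<close>

lemma log_moment_bound:
  fixes p \<eta> :: real
  assumes p: "p > 0" and \<eta>: "\<eta> > - 1"
  shows "\<exists>C>0. \<forall>A\<ge>0. \<forall>u. (\<forall>r>0. \<bar>u r\<bar> \<le> A * max 0 (- ln r)) \<longrightarrow>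
    (\<integral>\<^sup>+ r. ennreal (\<bar>u r\<bar> powr p * r powr \<eta>) \<partial>lebesgue_on {0<..}) \<le> ennreal (A powr p * C)"
proof -
  \<comment> \<open>With this exponent \<open>r powr (- \<epsilon> * p)\<close> uses up half of the distance of \<open>\<eta>\<close> from \<open>- 1\<close>.\<close>
  define \<epsilon> where "\<epsilon> = (\<eta> + 1) / (2 * p)"
  have \<epsilon>: "\<epsilon> > 0" using p \<eta> by (simp add: \<epsilon>_def)
  define C where "C = (1 / \<epsilon>) powr p * (1 / ((\<eta> - 1) / 2 + 1))"
  have "(\<eta> - 1) / 2 + 1 > 0" using \<eta> by (simp add: field_simps)
  then have C: "C > 0"
    unfolding C_def using \<epsilon> by (intro mult_pos_pos divide_pos_pos) simp_all
  have log_le: "max 0 (- ln r) powr p * r powr \<eta> \<le> (1 / \<epsilon>) powr p * r powr ((\<eta> - 1) / 2)"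
    if r: "0 < r" "r \<le> 1" for r
  proof -
    have "ln (1 / r) \<le> (1 / r) powr \<epsilon> / \<epsilon>"
      using r \<epsilon> by (intro ln_powr_bound) auto
    then have "max 0 (- ln r) \<le> 1 / \<epsilon> * r powr (- \<epsilon>)"
      using r \<epsilon> by (simp add: ln_div powr_divide powr_minus_divide mult.commute)
    then have "max 0 (- ln r) powr p \<le> (1 / \<epsilon> * r powr (- \<epsilon>)) powr p"
      using p by (intro powr_mono2) auto
    also have "\<dots> = (1 / \<epsilon>) powr p * r powr (- \<epsilon> * p)"
      using \<epsilon> by (subst powr_mult) (simp_all add: powr_powr)
    finally have "max 0 (- ln r) powr p * r powr \<eta> \<le> (1 / \<epsilon>) powr p * r powr (- \<epsilon> * p) * r powr \<eta>"
      by (rule mult_right_mono) simp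
    also have "\<dots> = (1 / \<epsilon>) powr p * r powr (- \<epsilon> * p + \<eta>)"
      by (simp only: powr_add mult.assoc)
    also have "- \<epsilon> * p + \<eta> = (\<eta> - 1) / 2"
      using p by (simp add: \<epsilon>_def field_simps)
    finally show ?thesis .
  qed
  have "((\<lambda>r. r powr ((\<eta> - 1) / 2)) has_integral (1 powr ((\<eta> - 1) / 2 + 1) / ((\<eta> - 1) / 2 + 1))) {0..1}"
    using \<eta> by (intro has_integral_powr_from_0) auto
  then have "((\<lambda>r. (1 / \<epsilon>) powr p * r powr ((\<eta> - 1) / 2)) has_integral C) {0..1}"
    unfolding C_def by (intro has_integral_mult_right) simp
  then have "((\<lambda>r. (1 / \<epsilon>) powr p * r powr ((\<eta> - 1) / 2)) has_integral C) {0<..1}"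
    by (rule has_integral_spike_set_eq[THEN iffD1, rotated 2])
      (auto intro: negligible_subset[of "{0}"])
  then have int: "((\<lambda>r. A powr p * ((1 / \<epsilon>) powr p * r powr ((\<eta> - 1) / 2))) has_integral A powr p * C) {0<..1}" for A
    by (rule has_integral_mult_right)
  have "(\<integral>\<^sup>+ r. ennreal (\<bar>u r\<bar> powr p * r powr \<eta>) \<partial>lebesgue_on {0<..}) \<le> ennreal (A powr p * C)"
    if A: "A \<ge> 0" and u: "\<forall>r>0. \<bar>u r\<bar> \<le> A * max 0 (- ln r)" for A u
  proof -
    have "(\<integral>\<^sup>+ r. ennreal (\<bar>u r\<bar> powr p * r powr \<eta>) \<partial>lebesgue_on {0<..}) \<le>
        (\<integral>\<^sup>+ r. ennreal (A powr p * ((1 / \<epsilon>) powr p * r powr ((\<eta> - 1) / 2))) * indicator {0<..1} r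
          \<partial>lebesgue_on {0<..})"
    proof (intro nn_integral_mono)
      fix r :: real assume "r \<in> space (lebesgue_on {0<..})"
      then have r: "r > 0" by (simp add: space_restrict_space)
      show "ennreal (\<bar>u r\<bar> powr p * r powr \<eta>) \<le>
        ennreal (A powr p * ((1 / \<epsilon>) powr p * r powr ((\<eta> - 1) / 2))) * indicator {0<..1} r"
      proof (cases "r \<le> 1")
        case True
        have "\<bar>u r\<bar> powr p * r powr \<eta> \<le> (A * max 0 (- ln r)) powr p * r powr \<eta>"
          using u r p by (intro mult_right_mono powr_mono2) auto
        also have "\<dots> = A powr p * (max 0 (- ln r) powr p * r powr \<eta>)"
          using A by (simp add: powr_mult)
        also have "\<dots> \<le> A powr p * ((1 / \<epsilon>) powr p * r powr ((\<eta> - 1) / 2))"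
          using log_le[OF r True] by (intro mult_left_mono) auto
        finally show ?thesis using r True by (simp add: ennreal_leI)
      next
        case False
        then have "max 0 (- ln r) = 0" by simp
        then have "u r = 0" using u r by force
        then show ?thesis using p by simp
      qed
    qed
    also have "\<dots> = ennreal (A powr p * C)"
      by (rule nn_integral_halfline[OF _ _ int]) auto
    finally show ?thesis .
  qed
  then show ?thesis using C by blast
qed

text \<open>
  The constant in front is the exact mass \<open>\<integral> r powr \<eta> dr\<close> of the interval that
  corresponds to \<open>y \<le> t \<le> y + 1\<close>.
\<close>

lemma plateau_lower_bound:
  fixes f :: "real \<Rightarrow> real" and \<eta> V y :: real
  assumes \<eta>: "\<eta> > - 1" and V: "V \<ge> 0"
    and f: "\<And>r. exp (- (y + 1)) \<le> r \<Longrightarrow> r \<le> exp (- y) \<Longrightarrow> f r = V"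
  shows "ennreal (V * ((1 - exp (- (\<eta> + 1))) / (\<eta> + 1) * exp (- (\<eta> + 1) * y))) \<le>
    (\<integral>\<^sup>+ r. ennreal (f r * r powr \<eta>) \<partial>lebesgue_on {0<..})"
proof -
  let ?S = "{exp (- (y + 1))..exp (- y)}"
  have sub: "?S \<subseteq> {0<..}"
    by (meson atLeastAtMost_iff exp_gt_zero greaterThan_iff less_le_trans subsetI)
  let ?F = "\<lambda>r. V * (r powr (\<eta> + 1) / (\<eta> + 1))"
  have "((\<lambda>r. V * r powr \<eta>) has_integral (?F (exp (- y)) - ?F (exp (- (y + 1))))) ?S"
  proof (rule fundamental_theorem_of_calculus)
    fix r assume "r \<in> ?S"
    then have r: "r > 0" using sub by auto
    have "((\<lambda>r. r powr (\<eta> + 1)) has_real_derivative (\<eta> + 1) * r powr (\<eta> + 1 - 1)) (at r)"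
      using r by (rule has_real_derivative_powr)
    then have "(?F has_real_derivative V * ((\<eta> + 1) * r powr (\<eta> + 1 - 1) / (\<eta> + 1))) (at r)"
      by (intro DERIV_cmult DERIV_cdivide)
    then have "(?F has_real_derivative V * r powr \<eta>) (at r)" using \<eta> by simp
    then show "(?F has_vector_derivative V * r powr \<eta>) (at r within ?S)"
      by (simp add: has_real_derivative_iff_has_vector_derivative has_vector_derivative_at_within)
  qed simp
  moreover have "?F (exp (- y)) - ?F (exp (- (y + 1))) =
      V * ((1 - exp (- (\<eta> + 1))) / (\<eta> + 1) * exp (- (\<eta> + 1) * y))"
  proof -
    have 1: "exp (- y) powr (\<eta> + 1) = exp (- (\<eta> + 1) * y)"
      by (simp add: exp_powr_real algebra_simps)
    have 2: "exp (- (y + 1)) powr (\<eta> + 1) = exp (- (\<eta> + 1)) * exp (- (\<eta> + 1) * y)"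
      unfolding exp_powr_real exp_add[symmetric] by (simp add: algebra_simps)
    show ?thesis unfolding 1 2 by (simp add: algebra_simps diff_divide_distrib)
  qed
  ultimately have "ennreal (V * ((1 - exp (- (\<eta> + 1))) / (\<eta> + 1) * exp (- (\<eta> + 1) * y))) =
      (\<integral>\<^sup>+ r. ennreal (V * r powr \<eta>) * indicator ?S r \<partial>lebesgue_on {0<..})"
    using sub V by (subst nn_integral_halfline[of ?S]) auto
  also have "\<dots> \<le> (\<integral>\<^sup>+ r. ennreal (f r * r powr \<eta>) \<partial>lebesgue_on {0<..})"
    by (intro nn_integral_mono) (auto simp: indicator_def f)
  finally show ?thesis .
qed

section \<open>Asymptotics of the exponential functional\<close>

lemma ennreal_divide_mono:
  fixes a b x :: ennreal
  assumes "a \<le> b" "x \<le> ennreal y" "0 < x"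
  shows "a / ennreal y \<le> b / x"
proof -
  obtain z where z: "x = ennreal z" "0 < z"
    using assms(2,3) by (cases x) (auto simp: top_unique)
  then have "z \<le> y"
    using assms(2) by (metis ennreal_le_iff2 not_le)
  then have "inverse (ennreal y) \<le> inverse x"
    using z by (simp add: inverse_ennreal le_imp_inverse_le ennreal_leI)
  then show ?thesis
    unfolding divide_ennreal_def using assms(1) by (intro mult_mono) auto
qed

lemma tendsto_infinity_mono:
  fixes g :: "nat \<Rightarrow> ennreal"
  assumes "(\<lambda>n. ennreal (h n)) \<longlonglongrightarrow> top" "\<And>n. ennreal (h n) \<le> g n"
  shows "g \<longlonglongrightarrow> \<infinity>"
  unfolding infinity_ennreal_def
  by (rule tendsto_sandwich[OF _ _ assms(1) tendsto_const]) (simp_all add: assms(2))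

text \<open>
  The height \<open>A\<close> of the plateau satisfies \<open>(c A) powr p' \<ge> T - O(1)\<close> for
  \<open>p' = p / (p - 1)\<close>: replacing \<open>c powr p * T\<close> by \<open>c powr p * T + K\<close>
  in the normalisation multiplies \<open>(c A) powr p' = T\<close> by \<open>(1 + K / (c powr p * T)) powr
  (- 1 / (p - 1))\<close>, which is \<open>1 - O(1 / T)\<close>. After exponentiation the error is a
  constant factor.
\<close>

lemma profile_height_lower_bound:
  fixes p c K T :: real
  assumes p: "p > 1" and c: "c > 0" and K: "K > 0" and T: "T > 0"
  shows "c powr (p / (p - 1)) * ((c powr p * T + K) powr (- 1 / p) * T) powr (p / (p - 1)) \<ge>
    T - K / (c powr p * (p - 1))"
proof -
  define s where "s = 1 / (p - 1)"
  define x where "x = c powr p * T"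
  have s: "s > 0" "p / (p - 1) = 1 + s" "p * s = 1 + s" "- 1 / p * (1 + s) = - s"
    using p by (simp_all add: s_def field_simps)
  have x: "x > 0" using c T by (simp add: x_def)
  have "((x + K) powr (- 1 / p) * T) powr (1 + s) =
      ((x + K) powr (- 1 / p)) powr (1 + s) * T powr (1 + s)"
    by (rule powr_mult)
  also have "((x + K) powr (- 1 / p)) powr (1 + s) = (x + K) powr (- s)"
    by (simp only: powr_powr s(4))
  also have "T powr (1 + s) = T * T powr s" using T by (simp add: powr_add)
  finally have "c powr (1 + s) * ((x + K) powr (- 1 / p) * T) powr (1 + s) =
      T * (c powr (p * s) * T powr s * (x + K) powr (- s))"
    by (simp only: s(3) mult_ac)
  also have "c powr (p * s) * T powr s = x powr s"
    using c T by (simp add: x_def powr_mult powr_powr)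
  also have "x powr s * (x + K) powr (- s) = exp (- s * ln ((x + K) / x))"
    using x K by (simp add: powr_def ln_div exp_add[symmetric] algebra_simps)
  finally have eq: "c powr (1 + s) * ((x + K) powr (- 1 / p) * T) powr (1 + s) =
      T * exp (- s * ln ((x + K) / x))" .
  have "ln ((x + K) / x) \<le> (x + K) / x - 1"
    using x K by (intro ln_le_minus_one) simp
  then have "ln ((x + K) / x) \<le> K / x" using x by (simp add: field_simps)
  then have "s * ln ((x + K) / x) \<le> s * (K / x)" using s by (intro mult_left_mono) auto
  then have "exp (- s * ln ((x + K) / x)) \<ge> 1 - s * (K / x)"
    using exp_ge_add_one_self[of "- s * ln ((x + K) / x)"] by simp
  then have "T * (1 - s * (K / x)) \<le> T * exp (- s * ln ((x + K) / x))"
    using T by (intro mult_left_mono) auto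
  moreover have "T * (1 - s * (K / x)) = T - K / (c powr p * (p - 1))"
    using T c p by (simp add: x_def s_def field_simps)
  ultimately show ?thesis using eq unfolding x_def s(2) by linarith
qed

lemma profile_height_upper_bound:
  fixes p c K T :: real
  assumes p: "p > 1" and c: "c > 0" and K: "K > 0" and T: "T > 0"
  shows "(c powr p * T + K) powr (- 1 / p) * T \<le> 1 / c * T powr (1 - 1 / p)"
proof -
  have "(c powr p * T + K) powr (- 1 / p) \<le> (c powr p * T) powr (- 1 / p)"
    using assms by (intro powr_mono2') auto
  also have "\<dots> = 1 / c * T powr (- 1 / p)"
    using assms by (simp add: powr_mult powr_powr powr_minus_divide)
  finally have "(c powr p * T + K) powr (- 1 / p) * T \<le> 1 / c * T powr (- 1 / p) * T"
    using T by (intro mult_right_mono) auto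
  also have "1 / c * T powr (- 1 / p) * T = 1 / c * T powr (1 - 1 / p)"
    using T powr_add[of T "- 1 / p" 1] by simp
  finally show ?thesis .
qed

text \<open>
  Only the plateau is used, with \<open>T + d\<close> for its beginning and \<open>S\<close> for a lower
  bound of the exponent there: the exponential contributes \<open>exp S\<close>, the mass of the plateau
  \<open>exp (- (\<eta> + 1) * T)\<close>, and the denominator at most a multiple of \<open>T powr (q (1 - 1
  / p))\<close>. For negative \<open>q\<close> the denominator is at most \<open>1\<close>, hence the
  \<open>max q 0\<close>.
\<close>

lemma exp_functional_lower_bound:
  fixes p \<eta> q h :: real
  assumes p: "p > 1" and \<eta>: "\<eta> > - 1" and h: "h \<ge> 0"
  shows "\<exists>C>0. \<forall>T A S \<beta> u. T \<ge> 1 \<longrightarrow> 0 \<le> A \<longrightarrow> A \<le> h * T powr (1 - 1 / p) \<longrightarrow>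
    1 \<le> S \<longrightarrow> S \<le> \<beta> * A powr (p / (p - 1)) \<longrightarrow>
    (\<forall>r. exp (- (T + d + 1)) \<le> r \<longrightarrow> r \<le> exp (- (T + d)) \<longrightarrow> u r = A) \<longrightarrow>
    ennreal (C * exp (S - (\<eta> + 1) * T) * T powr (- (1 - 1 / p) * max q 0)) \<le>
      exp_functional p \<eta> \<beta> q u"
proof -
  define C where "C = exp_p p 1 * exp (- 1 - (\<eta> + 1) * d) * (1 + h) powr (- max q 0) *
    ((1 - exp (- (\<eta> + 1))) / (\<eta> + 1))"
  have e1: "exp_p p 1 > 0" using exp_p_lower_bound(1)[OF p, of 1] by simp
  have \<kappa>: "(1 - exp (- (\<eta> + 1))) / (\<eta> + 1) > 0" using \<eta> by simp
  have C: "C > 0" unfolding C_def using e1 \<kappa> h by (intro mult_pos_pos) auto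
  have "ennreal (C * exp (S - (\<eta> + 1) * T) * T powr (- (1 - 1 / p) * max q 0)) \<le>
      exp_functional p \<eta> \<beta> q u"
    if T: "T \<ge> 1" and A: "0 \<le> A" "A \<le> h * T powr (1 - 1 / p)"
      and S: "1 \<le> S" "S \<le> \<beta> * A powr (p / (p - 1))"
      and u: "\<forall>r. exp (- (T + d + 1)) \<le> r \<longrightarrow> r \<le> exp (- (T + d)) \<longrightarrow> u r = A"
    for T A S \<beta> u
  proof -
    let ?x = "\<beta> * A powr (p / (p - 1))"
    have "exp (S - 1) * exp_p p 1 \<le> exp (?x - 1) * exp_p p 1"
      using S e1 by (intro mult_right_mono) auto
    also have "\<dots> \<le> exp_p p ?x"
      using S by (intro exp_p_lower_bound(2)[OF p]) simp
    finally have num: "exp (S - 1) * exp_p p 1 \<le> exp_p p ?x" .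
    have "1 \<le> T powr (1 - 1 / p)" using T p by (intro ge_one_powr_ge_zero) auto
    then have "1 + A \<le> (1 + h) * T powr (1 - 1 / p)" using A by (simp add: algebra_simps)
    then have "(1 + A) powr max q 0 \<le> ((1 + h) * T powr (1 - 1 / p)) powr max q 0"
      using A by (intro powr_mono2) auto
    also have "\<dots> = (1 + h) powr max q 0 * T powr ((1 - 1 / p) * max q 0)"
      using h by (simp add: powr_mult powr_powr)
    finally have den: "(1 + A) powr q \<le> (1 + h) powr max q 0 * T powr ((1 - 1 / p) * max q 0)"
      using powr_mono[of q "max q 0" "1 + A"] A by simp
    define V where "V = exp_p p ?x / (1 + A) powr q"
    have "exp (S - 1) * exp_p p 1 / ((1 + h) powr max q 0 * T powr ((1 - 1 / p) * max q 0)) \<le> V"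
      unfolding V_def using num den A e1
      by (intro frac_le) (auto intro: order_trans[OF mult_nonneg_nonneg num])
    then have "exp (S - 1) * exp_p p 1 * (1 + h) powr (- max q 0) * T powr (- (1 - 1 / p) * max q 0) \<le> V"
      by (simp only: powr_minus_divide mult_minus_left) simp
    then have "exp (S - 1) * exp_p p 1 * (1 + h) powr (- max q 0) * T powr (- (1 - 1 / p) * max q 0) *
        ((1 - exp (- (\<eta> + 1))) / (\<eta> + 1) * exp (- (\<eta> + 1) * (T + d))) \<le>
        V * ((1 - exp (- (\<eta> + 1))) / (\<eta> + 1) * exp (- (\<eta> + 1) * (T + d)))"
      by (intro mult_right_mono mult_nonneg_nonneg less_imp_le[OF \<kappa>]) simp_all
    also have "exp (S - 1) * exp_p p 1 * (1 + h) powr (- max q 0) * T powr (- (1 - 1 / p) * max q 0) *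
        ((1 - exp (- (\<eta> + 1))) / (\<eta> + 1) * exp (- (\<eta> + 1) * (T + d))) =
        exp_p p 1 * (1 + h) powr (- max q 0) * T powr (- (1 - 1 / p) * max q 0) *
        ((1 - exp (- (\<eta> + 1))) / (\<eta> + 1)) * (exp (S - 1) * exp (- (\<eta> + 1) * (T + d)))"
      by (simp only: mult_ac)
    also have "exp (S - 1) * exp (- (\<eta> + 1) * (T + d)) =
        exp (- 1 - (\<eta> + 1) * d) * exp (S - (\<eta> + 1) * T)"
      unfolding exp_add[symmetric] by (simp add: algebra_simps)
    also have "exp_p p 1 * (1 + h) powr (- max q 0) * T powr (- (1 - 1 / p) * max q 0) *
        ((1 - exp (- (\<eta> + 1))) / (\<eta> + 1)) * (exp (- 1 - (\<eta> + 1) * d) * exp (S - (\<eta> + 1) * T)) =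
        C * exp (S - (\<eta> + 1) * T) * T powr (- (1 - 1 / p) * max q 0)"
      by (simp only: C_def mult_ac)
    finally have "C * exp (S - (\<eta> + 1) * T) * T powr (- (1 - 1 / p) * max q 0) \<le>
        V * ((1 - exp (- (\<eta> + 1))) / (\<eta> + 1) * exp (- (\<eta> + 1) * (T + d)))" .
    then have "ennreal (C * exp (S - (\<eta> + 1) * T) * T powr (- (1 - 1 / p) * max q 0)) \<le>
        ennreal (V * ((1 - exp (- (\<eta> + 1))) / (\<eta> + 1) * exp (- (\<eta> + 1) * (T + d))))"
      by (rule ennreal_leI)
    also have "\<dots> \<le> exp_functional p \<eta> \<beta> q u"
      unfolding exp_functional_def
    proof (rule plateau_lower_bound[OF \<eta>])
      have "0 \<le> exp (S - 1) * exp_p p 1" using e1 by simp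
      then show "V \<ge> 0" unfolding V_def using num by (intro divide_nonneg_nonneg powr_ge_zero) linarith
      show "exp_p p (\<beta> * \<bar>u r\<bar> powr (p / (p - 1))) / (1 + \<bar>u r\<bar>) powr q = V"
        if "exp (- (T + d + 1)) \<le> r" "r \<le> exp (- (T + d))" for r
      proof -
        have "\<bar>u r\<bar> = A" using u that A by simp
        then show ?thesis by (simp add: V_def)
      qed
    qed
    finally show ?thesis .
  qed
  then show ?thesis using C by blast
qed

theorem theorem1p5:
  fixes k :: nat and p \<eta> \<gamma> \<theta> :: real and \<alpha> :: "nat \<Rightarrow> real"
  assumes "k \<ge> 1"
    and "p > 1"
    and "\<alpha> k - real k * p + 1 = 0"
    and "\<eta> > -1"
    and "\<gamma> = (2 * p - 1 + (p - 1) * \<eta>) / p"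
    and "\<theta> + 2 > \<gamma>"
    and "\<theta> > real (k div 2) * (\<theta> + 2 - \<gamma>) - 1"
  shows "\<exists>u :: nat \<Rightarrow> real \<Rightarrow> real.
    (\<forall>n. u n \<in> X_space k p \<alpha>) \<and>
    (\<forall>n. \<exists>v. has_nabla_L \<theta> \<gamma> k (u n) v \<and>
             wnorm p (\<alpha> k + real (k div 2) * (\<theta> - \<gamma>) * p) v \<le> 1) \<and>
    (\<forall>n. 0 < wnorm p \<eta> (u n) \<and> wnorm p \<eta> (u n) < \<infinity>) \<and>
    (\<forall>q < p / (p - 1).
       (\<lambda>n. exp_functional p \<eta> (beta0 k p \<eta> \<theta> \<gamma>) q (u n) / epowr (wnorm p \<eta> (u n)) p)
         \<longlonglongrightarrow> \<infinity>) \<and>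
    (\<forall>\<beta> > beta0 k p \<eta> \<theta> \<gamma>. \<forall>q\<ge>0.
       (\<lambda>n. exp_functional p \<eta> \<beta> q (u n)) \<longlonglongrightarrow> \<infinity>)"
proof -
  note p = \<open>p > 1\<close> and \<eta> = \<open>\<eta> > -1\<close>
  define c where "c = \<bar>coeff (nabla_symbol (\<gamma> - 1) (\<theta> + 2 - \<gamma>) k) 1\<bar>"
  define p' where "p' = p / (p - 1)"
  define \<beta>0 where "\<beta>0 = beta0 k p \<eta> \<theta> \<gamma>"
  have "\<gamma> - 1 = (p - 1) * (1 + \<eta>) / p"
    using p assms(5) by (simp add: field_simps)
  then have \<gamma>: "\<gamma> - 1 > 0" using p \<eta> by simp
  have \<beta>0: "\<beta>0 = (\<eta> + 1) * c powr p'" and c: "c > 0"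
    using beta0_eq_symbol(1)[where k = k and p = p and \<theta> = \<theta> and \<gamma> = \<gamma> and \<eta> = \<eta>]
      beta0_eq_symbol(2)[where k = k and \<theta> = \<theta> and \<gamma> = \<gamma>] assms(1,6,7) \<gamma>
    by (auto simp: \<beta>0_def c_def p'_def)
  obtain K B where K: "K > 0" and B: "B \<ge> 0" and prof: "\<forall>T\<ge>max 1 (real k). \<exists>u \<in> X_space k p \<alpha>.
    (\<exists>v. has_nabla_L \<theta> \<gamma> k u v \<and> wnorm p (\<alpha> k + real (k div 2) * (\<theta> - \<gamma>) * p) v \<le> 1) \<and>
    (\<forall>r>0. \<bar>u r\<bar> \<le> (c powr p * T + K) powr (- 1 / p) * B * max 0 (- ln r)) \<and>
    (\<forall>r. exp (- (T + real k + 1)) \<le> r \<longrightarrow> r \<le> exp (- (T + real k)) \<longrightarrow>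
      u r = (c powr p * T + K) powr (- 1 / p) * T)"
    using concentrating_profile[where k = k and p = p and \<alpha> = \<alpha> and \<gamma> = \<gamma> and \<theta> = \<theta>, OF assms(1-3), folded c_def] by blast
  obtain C where C: "C > 0" and moment: "\<And>A u. A \<ge> 0 \<Longrightarrow> (\<forall>r>0. \<bar>u r\<bar> \<le> A * max 0 (- ln r)) \<Longrightarrow>
    (\<integral>\<^sup>+ r. ennreal (\<bar>u r\<bar> powr p * r powr \<eta>) \<partial>lebesgue_on {0<..}) \<le> ennreal (A powr p * C)"
    using log_moment_bound[of p \<eta>] p \<eta> by auto
  define K1 where "K1 = K / (c powr p * (p - 1))"
  have K1: "K1 > 0" unfolding K1_def using K c p by simp
  \<comment> \<open>The summands added to \<open>n\<close> guarantee, in this order, \<open>T n \<ge> 1\<close>, \<open>T n \<ge> k\<close>, and that the lower bound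
    \<open>(\<eta> + 1) * (T n - K1)\<close> for the exponent is at least \<open>1\<close>.\<close>
  define T where "T = (\<lambda>n. real n + (1 + real k + K1 + 1 / (\<eta> + 1)))"
  have T: "T n \<ge> 1" "T n \<ge> real k" "(\<eta> + 1) * (T n - K1) \<ge> 1" for n
  proof -
    have "1 / (\<eta> + 1) > 0" using \<eta> by simp
    then show "T n \<ge> 1" "T n \<ge> real k" using K1 by (auto simp: T_def)
    have "(\<eta> + 1) * (T n - K1) \<ge> (\<eta> + 1) * (1 / (\<eta> + 1))"
      using \<eta> by (intro mult_left_mono) (auto simp: T_def)
    then show "(\<eta> + 1) * (T n - K1) \<ge> 1" using \<eta> by simp
  qed
  define l where "l = (\<lambda>n. (c powr p * T n + K) powr (- 1 / p))"
  have "\<forall>n. \<exists>u. u \<in> X_space k p \<alpha> \<and>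
    (\<exists>v. has_nabla_L \<theta> \<gamma> k u v \<and> wnorm p (\<alpha> k + real (k div 2) * (\<theta> - \<gamma>) * p) v \<le> 1) \<and>
    (\<forall>r>0. \<bar>u r\<bar> \<le> l n * B * max 0 (- ln r)) \<and>
    (\<forall>r. exp (- (T n + real k + 1)) \<le> r \<longrightarrow> r \<le> exp (- (T n + real k)) \<longrightarrow> u r = l n * T n)"
    using prof T unfolding l_def by (metis max.boundedI)
  then obtain u where u: "\<And>n. u n \<in> X_space k p \<alpha>"
    "\<And>n. \<exists>v. has_nabla_L \<theta> \<gamma> k (u n) v \<and> wnorm p (\<alpha> k + real (k div 2) * (\<theta> - \<gamma>) * p) v \<le> 1"
    "\<And>n. \<forall>r>0. \<bar>u n r\<bar> \<le> l n * B * max 0 (- ln r)"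
    "\<And>n. \<forall>r. exp (- (T n + real k + 1)) \<le> r \<longrightarrow> r \<le> exp (- (T n + real k)) \<longrightarrow> u n r = l n * T n"
    by metis
  let ?I = "\<lambda>n. \<integral>\<^sup>+ r. ennreal (\<bar>u n r\<bar> powr p * r powr \<eta>) \<partial>lebesgue_on {0<..}"
  define C1 where "C1 = B powr p * C / c powr p + 1"
  have C1: "C1 > 0" unfolding C1_def using C by (intro add_nonneg_pos) auto
  have lpos: "l n > 0" for n
    unfolding l_def using T(1)[of n] K by (simp add: add_nonneg_pos less_imp_neq[symmetric])
  have lp: "l n powr p \<le> 1 / (c powr p * T n)" for n
  proof -
    have "l n powr p = 1 / (c powr p * T n + K)"
      unfolding l_def powr_powr using p T(1)[of n] K by (simp add: powr_minus_divide add_nonneg_pos)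
    also have "\<dots> \<le> 1 / (c powr p * T n)"
      using K c T(1)[of n] by (intro divide_left_mono) (auto intro!: mult_pos_pos add_pos_pos)
    finally show ?thesis .
  qed
  have mass: "?I n \<le> ennreal (C1 / T n)" for n
  proof -
    have "?I n \<le> ennreal ((l n * B) powr p * C)"
      using u(3)[of n] B lpos[of n] by (intro moment) auto
    also have "\<dots> \<le> ennreal (C1 / T n)"
    proof (rule ennreal_leI)
      have "(l n * B) powr p * C = l n powr p * (B powr p * C)"
        using B lpos[of n] by (simp add: powr_mult)
      also have "\<dots> \<le> 1 / (c powr p * T n) * (B powr p * C)"
        using lp[of n] C by (intro mult_right_mono) auto
      also have "\<dots> = B powr p * C / c powr p / T n" by simp
      also have "\<dots> \<le> C1 / T n"
        using T(1)[of n] by (intro divide_right_mono) (auto simp: C1_def)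
      finally show "(l n * B) powr p * C \<le> C1 / T n" .
    qed
    finally show ?thesis .
  qed
  have mass_pos: "?I n > 0" for n
  proof -
    let ?V = "(l n * T n) powr p"
    have "0 < ?V * ((1 - exp (- (\<eta> + 1))) / (\<eta> + 1) * exp (- (\<eta> + 1) * (T n + real k)))"
      using lpos[of n] T(1)[of n] \<eta> by (intro mult_pos_pos divide_pos_pos) auto
    then have "0 < ennreal (?V * ((1 - exp (- (\<eta> + 1))) / (\<eta> + 1) * exp (- (\<eta> + 1) * (T n + real k))))"
      by simp
    also have "\<dots> \<le> ?I n"
      using u(4)[of n] lpos[of n] T(1)[of n] by (intro plateau_lower_bound \<eta>) auto
    finally show ?thesis .
  qed
  have norm: "0 < wnorm p \<eta> (u n)" "wnorm p \<eta> (u n) < \<infinity>" for n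
    using wnorm_positive_finite[of p "u n" \<eta>] p mass_pos[of n] le_less_trans[OF mass[of n], of top]
    by auto
  \<comment> \<open>From here on \<open>\<beta> = \<delta> * \<beta>0\<close>: the value \<open>\<delta> = 1\<close> serves the first limit, \<open>\<delta> > 1\<close> the second.\<close>
  have height: "\<delta> * ((\<eta> + 1) * (T n - K1)) \<le> (\<delta> * \<beta>0) * (l n * T n) powr p'" if "\<delta> \<ge> 1" for \<delta> n
  proof -
    have "T n - K1 \<le> c powr p' * (l n * T n) powr p'"
      unfolding p'_def l_def K1_def using T(1)[of n] by (intro profile_height_lower_bound p c K) simp
    then have "\<delta> * (\<eta> + 1) * (T n - K1) \<le> \<delta> * (\<eta> + 1) * (c powr p' * (l n * T n) powr p')"
      using that \<eta> by (intro mult_left_mono) auto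
    then show ?thesis by (simp add: \<beta>0 mult_ac)
  qed
  have lower: "\<exists>D>0. \<forall>n. ennreal (D * exp ((\<delta> - 1) * (\<eta> + 1) * T n) * T n powr (- (1 - 1 / p) * max q 0)) \<le>
      exp_functional p \<eta> (\<delta> * \<beta>0) q (u n)" if \<delta>: "\<delta> \<ge> 1" for \<delta> q
  proof -
    obtain D where D: "D > 0" and le: "\<forall>T A S \<beta> u. T \<ge> 1 \<longrightarrow> 0 \<le> A \<longrightarrow> A \<le> 1 / c * T powr (1 - 1 / p) \<longrightarrow>
      1 \<le> S \<longrightarrow> S \<le> \<beta> * A powr (p / (p - 1)) \<longrightarrow>
      (\<forall>r. exp (- (T + real k + 1)) \<le> r \<longrightarrow> r \<le> exp (- (T + real k)) \<longrightarrow> u r = A) \<longrightarrow>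
      ennreal (D * exp (S - (\<eta> + 1) * T) * T powr (- (1 - 1 / p) * max q 0)) \<le>
        exp_functional p \<eta> \<beta> q u"
      using exp_functional_lower_bound[OF p \<eta>, of "1 / c" "real k" q] c by auto
    have "ennreal (D * exp (- \<delta> * (\<eta> + 1) * K1) * exp ((\<delta> - 1) * (\<eta> + 1) * T n) *
        T n powr (- (1 - 1 / p) * max q 0)) \<le> exp_functional p \<eta> (\<delta> * \<beta>0) q (u n)" for n
    proof -
      let ?S = "\<delta> * ((\<eta> + 1) * (T n - K1))"
      have "exp (- \<delta> * (\<eta> + 1) * K1) * exp ((\<delta> - 1) * (\<eta> + 1) * T n) = exp (?S - (\<eta> + 1) * T n)"
        unfolding exp_add[symmetric] by (simp add: algebra_simps)
      moreover have "1 \<le> ?S"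
        using mult_mono[OF \<delta> T(3)[of n]] \<delta> by simp
      moreover have "l n * T n \<le> 1 / c * T n powr (1 - 1 / p)"
        unfolding l_def using T(1)[of n] by (intro profile_height_upper_bound p c K) simp
      ultimately show ?thesis
        using le[rule_format, of "T n" "l n * T n" ?S "\<delta> * \<beta>0" "u n"] T(1)[of n] lpos[of n]
          height[OF \<delta>, of n] u(4)[of n]
        by (simp add: p'_def mult.assoc)
    qed
    then show ?thesis using D by (intro exI[of _ "D * exp (- \<delta> * (\<eta> + 1) * K1)"]) auto
  qed
  have T_top: "filterlim T at_top sequentially"
    unfolding T_def by real_asymp
  \<comment> \<open>At \<open>\<delta> = 1\<close> the exponentials cancel; the denominator loses \<open>T n powr ((1 - 1 / p) * max q 0)\<close>, and
    dividing by the mass gains a factor \<open>T n\<close>.\<close>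
  have lim1: "(\<lambda>n. exp_functional p \<eta> \<beta>0 q (u n) / epowr (wnorm p \<eta> (u n)) p) \<longlonglongrightarrow> \<infinity>"
    if q: "q < p / (p - 1)" for q
  proof -
    obtain D where D: "D > 0" and le: "\<And>n. ennreal (D * T n powr (- (1 - 1 / p) * max q 0)) \<le>
        exp_functional p \<eta> \<beta>0 q (u n)"
      using lower[of 1 q] by auto
    define \<sigma> where "\<sigma> = 1 - (1 - 1 / p) * max q 0"
    have "(1 - 1 / p) * max q 0 < (1 - 1 / p) * (p / (p - 1))"
      using p q by (intro mult_strict_left_mono) auto
    also have "\<dots> = 1" using p by (simp add: field_simps)
    finally have \<sigma>: "\<sigma> > 0" by (simp add: \<sigma>_def)
    have "ennreal (D / C1 * T n powr \<sigma>) \<le>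
        exp_functional p \<eta> \<beta>0 q (u n) / epowr (wnorm p \<eta> (u n)) p" for n
    proof -
      have "D / C1 * T n powr \<sigma> = D * T n powr (- (1 - 1 / p) * max q 0) / (C1 / T n)"
      proof -
        have "T n powr \<sigma> = T n powr (1 + - (1 - 1 / p) * max q 0)"
          by (simp only: \<sigma>_def mult_minus_left diff_conv_add_uminus)
        also have "\<dots> = T n * T n powr (- (1 - 1 / p) * max q 0)"
          using T(1)[of n] by (subst powr_add) simp
        finally show ?thesis by simp
      qed
      then have "ennreal (D / C1 * T n powr \<sigma>) =
          ennreal (D * T n powr (- (1 - 1 / p) * max q 0)) / ennreal (C1 / T n)"
        using D C1 T(1)[of n] by (simp add: divide_ennreal)
      also have "\<dots> \<le> exp_functional p \<eta> \<beta>0 q (u n) / ?I n"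
        using ennreal_divide_mono[OF le mass mass_pos] .
      also have "?I n = epowr (wnorm p \<eta> (u n)) p"
        using p by (simp add: epowr_wnorm)
      finally show ?thesis .
    qed
    moreover have "filterlim (\<lambda>n. D / C1 * T n powr \<sigma>) at_top sequentially"
    proof -
      have "filterlim (\<lambda>x. D / C1 * x powr \<sigma>) at_top at_top"
        using D C1 \<sigma> by real_asymp
      from filterlim_compose[OF this T_top] show ?thesis .
    qed
    then have "(\<lambda>n. ennreal (D / C1 * T n powr \<sigma>)) \<longlonglongrightarrow> top"
      by (simp add: ennreal_tendsto_top_eq_at_top)
    ultimately show ?thesis
      by (intro tendsto_infinity_mono[where h = "\<lambda>n. D / C1 * T n powr \<sigma>"])
  qed
  \<comment> \<open>For \<open>\<delta> > 1\<close> an exponential in \<open>T n\<close> survives and beats every power.\<close>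
  have lim2: "(\<lambda>n. exp_functional p \<eta> \<beta> q (u n)) \<longlonglongrightarrow> \<infinity>" if \<beta>: "\<beta> > \<beta>0" for \<beta> q
  proof -
    define \<delta> where "\<delta> = \<beta> / \<beta>0"
    have "\<beta>0 > 0" using \<beta>0 \<eta> c by simp
    then have \<delta>: "\<delta> > 1" "\<delta> * \<beta>0 = \<beta>" using \<beta> by (simp_all add: \<delta>_def)
    obtain D where D: "D > 0" and le: "\<And>n. ennreal (D * exp ((\<delta> - 1) * (\<eta> + 1) * T n) *
        T n powr (- (1 - 1 / p) * max q 0)) \<le> exp_functional p \<eta> \<beta> q (u n)"
      using lower[of \<delta> q] \<delta> by auto
    define a where "a = (\<delta> - 1) * (\<eta> + 1)"
    define b where "b = - (1 - 1 / p) * max q 0"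
    have a: "a > 0" using \<delta> \<eta> by (simp add: a_def)
    have "filterlim (\<lambda>x. D * exp (a * x) * x powr b) at_top at_top"
      using D a by real_asymp
    from filterlim_compose[OF this T_top]
    have "(\<lambda>n. ennreal (D * exp (a * T n) * T n powr b)) \<longlonglongrightarrow> top"
      by (simp add: ennreal_tendsto_top_eq_at_top)
    then show ?thesis
      by (rule tendsto_infinity_mono) (use le in \<open>simp add: a_def b_def\<close>)
  qed
  show ?thesis
    using u(1,2) norm lim1 lim2 unfolding \<beta>0_def by (intro exI[of _ u]) blast
qed

end
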